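(* Let $d\ge 1$, $D=\{1,\ldots,d\}$, and let $\boldsymbol X$ be a random vector with exponent measure $\mu$, angular measure $\phi$ with respect to an arbitrary norm $\|\cdot\|$ on $\mathbb R^d$, associated multivariate generalized Pareto (mgp) random vector $\boldsymbol Y\sim H$, spectral random vector $\boldsymbol S$ of $H$, $\boldsymbol T$-generator $\boldsymbol T$ of $H$ and $\boldsymbol U$-generator $\boldsymbol U$ of $H$, all as specified in the context. For non-empty $J\subseteq D$, the following statements are equivalent: 1. The set $J$ is an extreme direction of $\boldsymbol X$, i.e. $\mu(\mathbb E_J)>0$. 2. $\phi(\mathbb S_J)>0$. 3. $\displaystyle\lim_{\epsilon\downarrow 0}\lim_{n\to\infty} n\,\mathsf P[\boldsymbol X\in \mathbb R_{n,J}^{\epsilon}]>0$. 4. $\displaystyle\lim_{\epsilon\downarrow 0}\limsup_{n\to\infty} n\,\mathsf P[\boldsymbol X\in \mathbb C_{n,J}^{\epsilon}]>0$. 5. $\mathsf P[Y_j>-\infty \text{ iff } j\in J]>0$. 6. $\mathsf P[U_j>-\infty \text{ iff } j\in J]>0$. 7. $\mathsf P[T_j>-\infty \text{ iff } j\in J]>0$. 8. $\mathsf P[S_j>-\infty \text{ iff } j\in J]>0$.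
   Context: Operations and comparisons of vectors are componentwise; $\boldsymbol x\not\le\boldsymbol 1$ means $x_j>1$ for at least one $j$; $e^{-\infty}=0$; $\boldsymbol x_J=(x_j)_{j\in J}$. A multivariate extreme-value (mev) distribution is a limit in distribution (with non-degenerate margins) of affinely normalized componentwise maxima of i.i.d. random vectors. Setting. $\boldsymbol\xi$ is a random vector in $\mathbb R^d$ with marginal cdfs $F_1,\ldots,F_d$ whose cdf lies in the domain of attraction of an mev distribution, and $\boldsymbol X=(X_1,\dots,X_d)$ with $X_j=-1/\ln F_j(\xi_j)$. $G^*$ is the mev distribution with unit-Fréchet margins ($G_j^*(x)=e^{-1/x}$, $x>0$) that is the limit in distribution of $\max_{i\le n}\boldsymbol X_i/n$, with $\boldsymbol X_i$ i.i.d. copies of $\boldsymbol X$. Put $\mathbb E=[0,\infty)^d\setminus\{\boldsymbol 0\}$. The exponent measure $\mu$ is the unique Borel measure concentrated on $\mathbb E$ with $G^*(\boldsymbol x)=\exp\{-\mu(\mathbb E\setminus[\boldsymbol 0,\boldsymbol x])\}$, $\boldsymbol x\in[\boldsymbol 0,\boldsymbol\infty]$; it is finite on Borel sets bounded away from $\boldsymbol 0$ and satisfies $\mu(cB)=c^{-1}\mu(B)$ for $c>0$. It is assumed that $n\,\mathsf P(\boldsymbol X\in nB)\to\mu(B)$ as $n\to\infty$ for every Borel $B\subset\mathbb E$ bounded away from $\boldsymbol 0$ with $\mu(\partial B)=0$. $\mathbb E_J=\{\boldsymbol x\in\mathbb E: x_j>0\text{ iff }j\in J\}$; $\mathbb S=\{\boldsymbol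 x\in\mathbb E:\|\boldsymbol x\|=1\}$; $\mathbb S_J=\{\boldsymbol w\in\mathbb S: w_j>0\text{ iff }j\in J\}$. The angular measure is $\phi(B)=\mu(\{\boldsymbol x\in\mathbb E:\|\boldsymbol x\|>1,\ \boldsymbol x/\|\boldsymbol x\|\in B\})$, $B\subseteq\mathbb S$ Borel. For $\epsilon>0$, $n\in\mathbb N$, $$\mathbb R_{n,J}^\epsilon=\{\boldsymbol x\in\mathbb E:\|\boldsymbol x\|>n,\ \boldsymbol x_J/n\in(\epsilon,\infty)^J,\ \boldsymbol x_{D\setminus J}/n\in[0,\epsilon]^{D\setminus J}\},$$ $$\mathbb C_{n,J}^\epsilon=\{\boldsymbol x\in\mathbb E:\|\boldsymbol x\|>n,\ \boldsymbol x_J/\|\boldsymbol x\|\in(\epsilon,\infty)^J,\ \boldsymbol x_{D\setminus J}/\|\boldsymbol x\|\in[0,\epsilon]^{D\setminus J}\}.$$ The stable tail dependence function (stdf) is $\ell(\boldsymbol x)=-\ln G^*(1/\boldsymbol x)=\mu(\mathbb E\setminus[\boldsymbol 0,1/\boldsymbol x])$. The mgp distribution $H=\mathrm{GP}(\tilde G)$, with $\tilde G(\boldsymbol x)=G^*(e^{x_1},\ldots,e^{x_d})$, is the law of the random vector $\boldsymbol Y$ in $[-\infty,\infty)^d$ determined by $$\mathsf P[e^{\boldsymbol Y}\in B]=\frac{\mu(B\cap\{\boldsymbol x\ge\boldsymbol 0:\boldsymbol x\not\le\boldsymbol 1\})}{\mu(\{\boldsymbol x\ge\boldsymbol 0:\boldsymbol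 x\not\le\boldsymbol 1\})},\quad B\subseteq[\boldsymbol 0,\boldsymbol\infty)\text{ Borel}.$$ Spectral random vector: $\boldsymbol S$ in $[-\infty,0]^d$ with $\mathsf P[\max(\boldsymbol S)=0]=1$, $\mathsf P[S_j>-\infty]>0$ for all $j$, $\mathsf E[e^{S_1}]=\dots=\mathsf E[e^{S_d}]$ and $\ell(\boldsymbol y)=\mathsf E[\max(\boldsymbol ye^{\boldsymbol S})]/\mathsf E[e^{S_1}]$ for all $\boldsymbol y\in[0,\infty)^d$; then $\boldsymbol Y\overset{d}{=}E+\boldsymbol S$ with $E$ a unit exponential variable independent of $\boldsymbol S$. $\boldsymbol T$-generator: $\boldsymbol T$ in $[-\infty,\infty)^d$ with $\mathsf P[\max(\boldsymbol T)>-\infty]=1$, $\mathsf P[T_j>-\infty]>0$ for all $j$, $\mathsf E[e^{T_j-\max(\boldsymbol T)}]$ equal for all $j$, and $\boldsymbol S\overset{d}{=}\boldsymbol T-\max(\boldsymbol T)$. $\boldsymbol U$-generator: $\boldsymbol U$ in $[-\infty,\infty)^d$ with $\mathsf E[e^{U_j}]=1$ for all $j$ (normalization assumed without loss of generality) and $\ell(\boldsymbol y)=\mathsf E[\max(\boldsymbol ye^{\boldsymbol U})]$ for all $\boldsymbol y\in[0,\infty)^d$. *)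

theory Defs
  imports "HOL-Probability.Probability"
begin

text \<open>
  The index set \<open>D = {1, \<dots>, d}\<close> is a finite type \<open>'d\<close>. Random vectors in \<open>\<real>\<^sup>d\<close> have values in
  \<open>real ^ 'd\<close>. Random vectors with possibly infinite components have values in \<open>'d \<Rightarrow> ereal\<close>,
  equipped with the product of the Borel sigma-algebras.
\<close>

section \<open>Norms and distribution functions\<close>

definition vector_norm :: "(real ^ 'd \<Rightarrow> real) \<Rightarrow> bool" where
  "vector_norm N \<longleftrightarrow>
     (\<forall>x. 0 \<le> N x) \<and> (\<forall>x. N x = 0 \<longleftrightarrow> x = 0) \<and>
     (\<forall>c x. N (c *\<^sub>R x) = \<bar>c\<bar> * N x) \<and> (\<forall>x y. N (x + y) \<le> N x + N y)"

text \<open>The exponential on \<open>[-\<infinity>, \<infinity>)\<close> with \<open>e\<^sup>-\<^sup>\<infinity> = 0\<close>; the value at \<open>\<infinity>\<close> is irrelevant.\<close>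

definition eexp :: "ereal \<Rightarrow> real" where
  "eexp x = (if x = -\<infinity> then 0 else exp (real_of_ereal x))"

definition marginal :: "(real ^ 'd) measure \<Rightarrow> 'd \<Rightarrow> real measure" where
  "marginal P j = distr P borel (\<lambda>x. x $ j)"

text \<open>The joint distribution function, also at points with infinite coordinates.\<close>

definition joint_cdf :: "(real ^ 'd) measure \<Rightarrow> ('d \<Rightarrow> ereal) \<Rightarrow> real" where
  "joint_cdf P x = measure P {y. \<forall>j. ereal (y $ j) \<le> x j}"

section \<open>Multivariate extreme-value distributions\<close>

definition weak_limit :: "(nat \<Rightarrow> (real ^ 'd) measure) \<Rightarrow> (real ^ 'd) measure \<Rightarrow> bool" where
  "weak_limit Ps P \<longleftrightarrow>
     (\<forall>f :: real ^ 'd \<Rightarrow> real. continuous_on UNIV f \<and> bounded (range f) \<longrightarrow>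
        (\<lambda>n. integral\<^sup>L (Ps n) f) \<longlonglongrightarrow> integral\<^sup>L P f)"

text \<open>
  The law of \<open>(max\<^bsub>i<n\<^esub> \<xi>\<^sub>i - b) / a\<close> (all operations componentwise) for \<open>\<xi>\<^sub>i\<close> i.i.d. with law \<open>P\<close>,
  realized as the coordinates of a product space; \<open>n = 0\<close> plays no role.
\<close>

definition normalized_max_law ::
  "(real ^ 'd) measure \<Rightarrow> nat \<Rightarrow> real ^ 'd \<Rightarrow> real ^ 'd \<Rightarrow> (real ^ 'd) measure" where
  "normalized_max_law P n a b =
     distr (Pi\<^sub>M {..<n} (\<lambda>_. P)) borel (\<lambda>x. \<chi> j. (Max ((\<lambda>i. x i $ j) ` {..<n}) - b $ j) / a $ j)"

definition in_domain_of_attraction :: "(real ^ 'd) measure \<Rightarrow> (real ^ 'd) measure \<Rightarrow> bool" where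
  "in_domain_of_attraction P G \<longleftrightarrow>
     (\<exists>a b. (\<forall>n j. 0 < a n $ j) \<and> weak_limit (\<lambda>n. normalized_max_law P n (a n) (b n)) G)"

definition mev_distribution :: "(real ^ 'd) measure \<Rightarrow> bool" where
  "mev_distribution G \<longleftrightarrow>
     prob_space G \<and> sets G = sets borel \<and>
     (\<forall>j c. measure (marginal G j) {c} \<noteq> 1) \<and>
     (\<exists>P. prob_space P \<and> sets P = sets borel \<and> in_domain_of_attraction P G)"

definition unit_frechet_margins :: "(real ^ 'd) measure \<Rightarrow> bool" where
  "unit_frechet_margins G \<longleftrightarrow> (\<forall>j. \<forall>x>0. cdf (marginal G j) x = exp (- 1 / x))"

text \<open>
  \<open>X\<^sub>j = -1 / ln F\<^sub>j(\<xi>\<^sub>j)\<close>. Since \<open>ln 0 = 0\<close> and \<open>1 / 0 = 0\<close> in HOL, the convention-dependent cases are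
  \<open>F\<^sub>j(\<xi>\<^sub>j) = 0\<close>, where \<open>X\<^sub>j = 0\<close> is the intended value, and \<open>F\<^sub>j(\<xi>\<^sub>j) = 1\<close>, where \<open>X\<^sub>j\<close> should be \<open>\<infinity>\<close>.
  The latter has probability zero if the law of \<open>\<xi>\<close> is in the domain of attraction of an
  extreme-value distribution.
\<close>

definition frechet_standardization :: "'a measure \<Rightarrow> ('a \<Rightarrow> real ^ 'd) \<Rightarrow> 'a \<Rightarrow> real ^ 'd" where
  "frechet_standardization M \<xi> \<omega> =
     (\<chi> j. - 1 / ln (cdf (marginal (distr M borel \<xi>) j) (\<xi> \<omega> $ j)))"

text \<open>\<open>G\<close> is the limit in distribution of \<open>max\<^bsub>i<n\<^esub> X\<^sub>i / n\<close> and has unit-Frechet margins.\<close>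

definition standardized_mev_limit ::
  "'a measure \<Rightarrow> ('a \<Rightarrow> real ^ 'd) \<Rightarrow> (real ^ 'd) measure \<Rightarrow> bool" where
  "standardized_mev_limit M X G \<longleftrightarrow>
     mev_distribution G \<and> unit_frechet_margins G \<and>
     weak_limit (\<lambda>n. normalized_max_law (distr M borel X) n (\<chi> j. real n) 0) G"

section \<open>Exponent measure, angular measure and faces\<close>

definition punctured_orthant :: "(real ^ 'd) set" ("\<bbbE>") where
  "\<bbbE> = {x. (\<forall>j. 0 \<le> x $ j) \<and> x \<noteq> 0}"

definition exponent_measure :: "(real ^ 'd) measure \<Rightarrow> (real ^ 'd) measure \<Rightarrow> bool" where
  "exponent_measure G \<mu> \<longleftrightarrow>
     sets \<mu> = sets borel \<and> emeasure \<mu> (- \<bbbE>) = 0 \<and>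
     (\<forall>x :: 'd \<Rightarrow> ereal. (\<forall>j. 0 \<le> x j) \<longrightarrow>
        joint_cdf G x = eexp (- enn2ereal (emeasure \<mu> (\<bbbE> - {y. \<forall>j. ereal (y $ j) \<le> x j}))))"

text \<open>
  The topological boundary is taken relative to the state space \<open>\<bbbE>\<close>; the boundary in \<open>real ^ 'd\<close>
  would contain parts of the faces of the orthant, which may have positive mass.
\<close>

definition regularly_varying ::
  "'a measure \<Rightarrow> ('a \<Rightarrow> real ^ 'd) \<Rightarrow> (real ^ 'd) measure \<Rightarrow> bool" where
  "regularly_varying M X \<mu> \<longleftrightarrow>
     (\<forall>B \<in> sets borel. B \<subseteq> \<bbbE> \<and> 0 \<notin> closure B \<and> emeasure \<mu> (top_of_set \<bbbE> frontier_of B) = 0 \<longrightarrow>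
        (\<lambda>n. ennreal (real n * \<P>(\<omega> in M. X \<omega> \<in> (\<lambda>x. real n *\<^sub>R x) ` B))) \<longlonglongrightarrow> emeasure \<mu> B)"

definition face :: "'d set \<Rightarrow> (real ^ 'd) set" where
  "face J = {x \<in> \<bbbE>. \<forall>j. 0 < x $ j \<longleftrightarrow> j \<in> J}"

definition extreme_direction :: "(real ^ 'd) measure \<Rightarrow> 'd set \<Rightarrow> bool" where
  "extreme_direction \<mu> J \<longleftrightarrow> 0 < emeasure \<mu> (face J)"

definition unit_sphere :: "(real ^ 'd \<Rightarrow> real) \<Rightarrow> (real ^ 'd) set" where
  "unit_sphere N = {w \<in> \<bbbE>. N w = 1}"

definition sphere_face :: "(real ^ 'd \<Rightarrow> real) \<Rightarrow> 'd set \<Rightarrow> (real ^ 'd) set" where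
  "sphere_face N J = {w \<in> unit_sphere N. \<forall>j. 0 < w $ j \<longleftrightarrow> j \<in> J}"

definition angular_measure ::
  "(real ^ 'd \<Rightarrow> real) \<Rightarrow> (real ^ 'd) measure \<Rightarrow> (real ^ 'd) set \<Rightarrow> ennreal" where
  "angular_measure N \<mu> B = emeasure \<mu> {x \<in> \<bbbE>. 1 < N x \<and> x /\<^sub>R N x \<in> B}"

definition rectangle_region ::
  "(real ^ 'd \<Rightarrow> real) \<Rightarrow> real \<Rightarrow> nat \<Rightarrow> 'd set \<Rightarrow> (real ^ 'd) set" where
  "rectangle_region N \<epsilon> n J =
     {x \<in> \<bbbE>. real n < N x \<and> (\<forall>j\<in>J. x $ j / real n \<in> {\<epsilon><..}) \<and> (\<forall>j\<in>- J. x $ j / real n \<in> {0..\<epsilon>})}"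

definition cone_region ::
  "(real ^ 'd \<Rightarrow> real) \<Rightarrow> real \<Rightarrow> nat \<Rightarrow> 'd set \<Rightarrow> (real ^ 'd) set" where
  "cone_region N \<epsilon> n J =
     {x \<in> \<bbbE>. real n < N x \<and> (\<forall>j\<in>J. x $ j / N x \<in> {\<epsilon><..}) \<and> (\<forall>j\<in>- J. x $ j / N x \<in> {0..\<epsilon>})}"

section \<open>Generalized Pareto vectors and their generators\<close>

text \<open>The coordinates of \<open>1 / y\<close> are in \<open>(0, \<infinity>]\<close>, with \<open>1 / 0 = \<infinity>\<close> in \<open>ereal\<close>.\<close>

definition stdf :: "(real ^ 'd) measure \<Rightarrow> real ^ 'd \<Rightarrow> real" where
  "stdf G y = - ln (joint_cdf G (\<lambda>j. 1 / ereal (y $ j)))"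

abbreviation ext_vec :: "('d \<Rightarrow> ereal) measure" where
  "ext_vec \<equiv> Pi\<^sub>M UNIV (\<lambda>_. borel)"

definition mgp_vector :: "(real ^ 'd) measure \<Rightarrow> 'b measure \<Rightarrow> ('b \<Rightarrow> 'd \<Rightarrow> ereal) \<Rightarrow> bool" where
  "mgp_vector \<mu> M Y \<longleftrightarrow>
     prob_space M \<and> Y \<in> M \<rightarrow>\<^sub>M ext_vec \<and> (\<forall>\<omega>\<in>space M. \<forall>j. Y \<omega> j < \<infinity>) \<and>
     (let A = {x. (\<forall>j. 0 \<le> x $ j) \<and> \<not> (\<forall>j. x $ j \<le> 1)} in
      \<forall>B \<in> sets borel. B \<subseteq> {x. \<forall>j. 0 \<le> x $ j} \<longrightarrow>
        \<P>(\<omega> in M. (\<chi> j. eexp (Y \<omega> j)) \<in> B) = measure \<mu> (B \<inter> A) / measure \<mu> A)"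

definition spectral_vector ::
  "(real ^ 'd) measure \<Rightarrow> 'b measure \<Rightarrow> ('b \<Rightarrow> 'd \<Rightarrow> ereal) \<Rightarrow> bool" where
  "spectral_vector G M S \<longleftrightarrow>
     prob_space M \<and> S \<in> M \<rightarrow>\<^sub>M ext_vec \<and> (\<forall>\<omega>\<in>space M. \<forall>j. S \<omega> j \<le> 0) \<and>
     \<P>(\<omega> in M. Max (range (S \<omega>)) = 0) = 1 \<and>
     (\<forall>j. 0 < \<P>(\<omega> in M. -\<infinity> < S \<omega> j)) \<and>
     (\<forall>i j. (\<integral>\<omega>. eexp (S \<omega> i) \<partial>M) = (\<integral>\<omega>. eexp (S \<omega> j) \<partial>M)) \<and>
     (\<forall>i y. (\<forall>j. 0 \<le> y $ j) \<longrightarrow>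
        stdf G y = (\<integral>\<omega>. Max (range (\<lambda>j. y $ j * eexp (S \<omega> j))) \<partial>M) / (\<integral>\<omega>. eexp (S \<omega> i) \<partial>M))"

text \<open>
  The generator \<open>T\<close> refers to a spectral random vector \<open>S\<close> on a possibly different probability space
  \<open>M\<^sub>S\<close>. The value of \<open>T\<^sub>j - max T\<close> on the null event \<open>max T = -\<infinity>\<close> is irrelevant.
\<close>

definition T_generator ::
  "'c measure \<Rightarrow> ('c \<Rightarrow> 'd \<Rightarrow> ereal) \<Rightarrow> 'b measure \<Rightarrow> ('b \<Rightarrow> 'd \<Rightarrow> ereal) \<Rightarrow> bool" where
  "T_generator M\<^sub>S S M T \<longleftrightarrow>
     prob_space M \<and> T \<in> M \<rightarrow>\<^sub>M ext_vec \<and> (\<forall>\<omega>\<in>space M. \<forall>j. T \<omega> j < \<infinity>) \<and>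
     \<P>(\<omega> in M. -\<infinity> < Max (range (T \<omega>))) = 1 \<and>
     (\<forall>j. 0 < \<P>(\<omega> in M. -\<infinity> < T \<omega> j)) \<and>
     (\<forall>i j. (\<integral>\<omega>. eexp (T \<omega> i - Max (range (T \<omega>))) \<partial>M) = (\<integral>\<omega>. eexp (T \<omega> j - Max (range (T \<omega>))) \<partial>M)) \<and>
     distr M\<^sub>S ext_vec S = distr M ext_vec (\<lambda>\<omega> j. T \<omega> j - Max (range (T \<omega>)))"

text \<open>The condition \<open>E[e\<^sup>U\<^sub>j] = 1\<close> entails integrability, as non-integrable functions have integral 0.\<close>

definition U_generator ::
  "(real ^ 'd) measure \<Rightarrow> 'b measure \<Rightarrow> ('b \<Rightarrow> 'd \<Rightarrow> ereal) \<Rightarrow> bool" where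
  "U_generator G M U \<longleftrightarrow>
     prob_space M \<and> U \<in> M \<rightarrow>\<^sub>M ext_vec \<and> (\<forall>\<omega>\<in>space M. \<forall>j. U \<omega> j < \<infinity>) \<and>
     (\<forall>j. (\<integral>\<omega>. eexp (U \<omega> j) \<partial>M) = 1) \<and>
     (\<forall>y. (\<forall>j. 0 \<le> y $ j) \<longrightarrow>
        stdf G y = (\<integral>\<omega>. Max (range (\<lambda>j. y $ j * eexp (U \<omega> j))) \<partial>M))"

definition all_equivalent :: "bool list \<Rightarrow> bool" where
  "all_equivalent ps \<longleftrightarrow> (\<forall>p\<in>set ps. \<forall>q\<in>set ps. p \<longleftrightarrow> q)"

end

theory Submission
  imports Defs
begin

text \<open>
  Proof idea. For \<open>V = e\<^sup>U\<close>, or \<open>V = e\<^sup>S / E[e\<^sup>S\<^sub>1]\<close>, the formula for the stable tail dependence function says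
  that \<open>\<mu>\<close> agrees on the complements of boxes with the image of \<open>P \<otimes> ds\<close> under \<open>(\<omega>, s) \<mapsto> V(\<omega>) / s\<close>. These
  sets determine a measure on \<open>\<bbbE>\<close>, so \<open>\<mu>\<close> is that image. A ray through \<open>V(\<omega>)\<close> stays in the open
  face of \<open>V(\<omega>)\<close> and eventually leaves every bounded set; hence, for every part of the face \<open>J\<close> that
  contains a final piece of each of its rays, having positive \<open>\<mu>\<close>-mass is equivalent to \<open>P(V \<in> face J) > 0\<close>.
  This covers the face itself and its parts outside the unit ball and outside the unit box, that is,
  the statements on \<open>\<mu>\<close>, \<open>\<phi>\<close>, \<open>Y\<close>, \<open>U\<close>, \<open>S\<close> and, through \<open>S\<close>, on \<open>T\<close>.

  Both iterated limits are equal to the mass of the part of the face outside the unit ball. The representation shows that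
  spheres and hyperplanes \<open>{x\<^sub>j = \<epsilon>}\<close> are null, so that the rectangles are continuity sets. The
  cones need not be, but they can be enclosed between cones whose two thresholds avoid
  the countably many levels of positive mass.
\<close>

section \<open>Measurability of the orthant and its faces\<close>

lemma borel_measurable_vec_iff:
  fixes f :: "'a \<Rightarrow> real ^ 'd"
  shows "f \<in> borel_measurable M \<longleftrightarrow> (\<forall>j. (\<lambda>x. f x $ j) \<in> borel_measurable M)"
  by (subst borel_measurable_euclidean_space) (auto simp: Basis_vec_def inner_axis)

lemma borel_measurable_vec_nth [measurable]: "(\<lambda>x :: real ^ 'd. x $ j) \<in> borel_measurable borel"
  using borel_measurable_vec_iff[of "\<lambda>x. x" borel] by simp

lemma atMost_vec_borel [measurable]: "{..x :: real ^ 'd} \<in> sets borel"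
  unfolding borel_eq_atMost by (rule in_measure_of) auto

lemma punctured_orthant_borel [measurable]: "\<bbbE> \<in> sets borel"
proof -
  have "\<bbbE> = (\<Inter>j. {x :: real ^ 'd. 0 \<le> x $ j}) - {0}"
    by (auto simp: punctured_orthant_def)
  also have "\<dots> \<in> sets borel"
    by (intro sets.Diff sets.finite_INT) (auto simp flip: space_borel)
  finally show ?thesis .
qed

lemma face_borel [measurable]:
  fixes J :: "'d::finite set"
  shows "face J \<in> sets borel"
proof -
  have "face J = \<bbbE> \<inter> (\<Inter>j. {x :: real ^ 'd. 0 < x $ j \<longleftrightarrow> j \<in> J})"
    by (auto simp: face_def)
  also have "\<dots> \<in> sets borel"
    by (intro sets.Int punctured_orthant_borel sets.finite_INT) (auto simp flip: space_borel)
  finally show ?thesis .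
qed

lemma face_subset: "face J \<subseteq> \<bbbE>"
  by (auto simp: face_def)

lemma face_iff:
  assumes "J \<noteq> {}" "\<And>j. 0 \<le> x $ j"
  shows "x \<in> face J \<longleftrightarrow> (\<forall>j. 0 < x $ j \<longleftrightarrow> j \<in> J)"
  using assms by (auto simp: face_def punctured_orthant_def)

text \<open>Each point of \<open>\<bbbE>\<close> has a positive coordinate, which exceeds
  \<open>1 / real (Suc m)\<close> for large \<open>m\<close>. The pieces are box complements, on
  which the measures to be compared are finite; they serve to exhaust
  \<open>\<bbbE>\<close>.\<close>

lemma punctured_orthant_UN:
  "(\<bbbE> :: (real ^ 'd) set) = (\<Union>m. \<bbbE> - {..\<chi> j. 1 / real (Suc m)})"
proof -
  have "\<exists>m. \<not> x \<le> (\<chi> j. 1 / real (Suc m))" if "x \<in> \<bbbE>" for x :: "real ^ 'd"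
  proof -
    from that obtain j where "0 < x $ j"
      by (auto simp: punctured_orthant_def vec_eq_iff less_le)
    then obtain m where "1 / real (Suc m) < x $ j"
      using nat_approx_posE by auto
    then show ?thesis
      by (intro exI[of _ m]) (auto simp: less_eq_vec_def not_le intro!: exI[of _ j])
  qed
  then show ?thesis by auto
qed

lemma eexp_nonneg: "0 \<le> eexp x"
  by (simp add: eexp_def)

lemma eexp_pos_iff: "0 < eexp x \<longleftrightarrow> - \<infinity> < x"
  by (auto simp: eexp_def)

lemma borel_measurable_eexp [measurable]: "eexp \<in> borel_measurable borel"
  unfolding eexp_def by measurable

section \<open>Uniqueness of measures on the punctured orthant\<close>

text \<open>Within a box complement, a box is the difference of two nested box complements, so
  finite values on box complements determine its mass.\<close>

lemma emeasure_orthant_box: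
  fixes \<mu> :: "(real ^ 'd) measure"
  assumes sets: "sets \<mu> = sets borel"
    and fin: "emeasure \<mu> (\<bbbE> - {..c}) \<noteq> \<infinity>" "emeasure \<mu> (\<bbbE> - {..x}) \<noteq> \<infinity>"
    and eq: "m = (\<chi> j. min (x $ j) (c $ j))"
  shows "emeasure \<mu> ((\<bbbE> - {..c}) \<inter> {..x}) = emeasure \<mu> (\<bbbE> - {..m}) - emeasure \<mu> (\<bbbE> - {..x})"
proof -
  have [measurable]: "\<And>A. A \<in> sets borel \<Longrightarrow> A \<in> sets \<mu>" using sets by simp
  have "(\<bbbE> - {..c}) \<inter> {..x} = (\<bbbE> - {..m}) - (\<bbbE> - {..x})"
    by (auto simp: eq less_eq_vec_def)
  moreover have "\<bbbE> - {..x} \<subseteq> \<bbbE> - {..m}"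
    by (auto simp: eq less_eq_vec_def)
  ultimately show ?thesis
    using fin by (simp add: emeasure_Diff)
qed

text \<open>The measures may be infinite near the origin, and box complements are in general not
  stable under intersection. The comparison is therefore made inside a fixed
  \<open>\<bbbE> - {..c}\<close>, of finite mass, where the lower boxes \<open>{..x}\<close> form an
  intersection-stable generator; shrinking \<open>c\<close> then covers
  \<open>\<bbbE>\<close>.\<close>

lemma measure_eq_on_orthant:
  fixes \<mu> \<nu> :: "(real ^ 'd) measure"
  assumes sets: "sets \<mu> = sets borel" "sets \<nu> = sets borel"
    and eq: "\<And>x. (\<And>j. 0 < x $ j) \<Longrightarrow> emeasure \<mu> (\<bbbE> - {..x}) = emeasure \<nu> (\<bbbE> - {..x})"
    and fin: "\<And>x. (\<And>j. 0 < x $ j) \<Longrightarrow> emeasure \<mu> (\<bbbE> - {..x}) \<noteq> \<infinity>"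
    and A: "A \<in> sets borel" "A \<subseteq> \<bbbE>"
  shows "emeasure \<mu> A = emeasure \<nu> A"
proof -
  have [measurable]: "\<And>A. A \<in> sets borel \<Longrightarrow> A \<in> sets \<mu>" "\<And>A. A \<in> sets borel \<Longrightarrow> A \<in> sets \<nu>"
    using sets by simp_all
  have key: "emeasure \<mu> (B \<inter> (\<bbbE> - {..c})) = emeasure \<nu> (B \<inter> (\<bbbE> - {..c}))"
    if c: "\<And>j. 0 < c $ j" and [measurable]: "B \<in> sets borel" for B c
  proof -
    define C where "C = \<bbbE> - {..c}"
    have [measurable]: "C \<in> sets borel" unfolding C_def by measurable
    have pos: "emeasure \<mu> (C \<inter> {..x}) = emeasure \<nu> (C \<inter> {..x})" if x: "\<And>j. 0 < x $ j" for x
    proof -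
      define m where "m = (\<chi> j. min (x $ j) (c $ j))"
      have m: "\<And>j. 0 < m $ j" using x c by (auto simp: m_def)
      show ?thesis
        unfolding C_def
        using emeasure_orthant_box[OF sets(1) fin fin m_def] emeasure_orthant_box[OF sets(2) _ _ m_def]
          eq fin c x m by metis
    qed
    \<comment> \<open>Equality is assumed for strictly positive corners only. A negative coordinate
      makes the set empty; a zero coordinate is reached by boxes decreasing from above.\<close>
    have all: "emeasure \<mu> (C \<inter> {..x}) = emeasure \<nu> (C \<inter> {..x})" for x
    proof (cases "\<forall>j. 0 \<le> x $ j")
      case False
      then have "C \<inter> {..x} = {}"
        by (auto simp: C_def punctured_orthant_def less_eq_vec_def) (meson order_trans)
      then show ?thesis by simp
    next
      case True
      define D where "D m = C \<inter> {..(\<chi> j. x $ j + 1 / real (Suc m))}" for m :: nat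
      have D: "range D \<subseteq> sets borel" 
        unfolding D_def by (intro image_subsetI sets.Int \<open>C \<in> sets borel\<close> atMost_vec_borel)
      have dec: "decseq D"
      proof (rule decseq_SucI)
        fix m
        have "1 / real (Suc (Suc m)) \<le> 1 / real (Suc m)" by (simp add: field_simps)
        then have "(\<chi> j. x $ j + 1 / real (Suc (Suc m))) \<le> (\<chi> j. x $ j + 1 / real (Suc m))"
          by (simp add: less_eq_vec_def)
        then show "D (Suc m) \<subseteq> D m"
          unfolding D_def by (auto intro: order_trans)
      qed
      have "(\<Inter>m. D m) = C \<inter> {..x}"
      proof (intro set_eqI iffI)
        fix y assume y: "y \<in> (\<Inter>m. D m)"
        have "y $ j \<le> x $ j" for j
        proof (rule field_le_epsilon)
          fix e :: real assume "0 < e"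
          then obtain m where "1 / real (Suc m) < e" using nat_approx_posE by auto
          moreover have "y $ j \<le> x $ j + 1 / real (Suc m)"
            using y by (auto simp: D_def less_eq_vec_def)
          ultimately show "y $ j \<le> x $ j + e" by linarith
        qed
        then show "y \<in> C \<inter> {..x}" using y by (auto simp: D_def less_eq_vec_def)
      next
        fix y assume "y \<in> C \<inter> {..x}"
        then show "y \<in> (\<Inter>m. D m)"
          by (auto simp: D_def less_eq_vec_def intro!: add_increasing2)
      qed
      moreover have eqD: "emeasure \<mu> (D m) = emeasure \<nu> (D m)" for m
        unfolding D_def using True by (intro pos) (auto intro!: add_nonneg_pos)
      moreover have finD: "emeasure \<mu> (D m) \<noteq> \<infinity>" for m
        using emeasure_mono[of "D m" C \<mu>] fin[OF c] unfolding C_def[symmetric]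
        by (auto simp: D_def top_unique)
      ultimately have "(\<lambda>m. emeasure \<mu> (D m)) \<longlonglongrightarrow> emeasure \<mu> (C \<inter> {..x})"
        "(\<lambda>m. emeasure \<mu> (D m)) \<longlonglongrightarrow> emeasure \<nu> (C \<inter> {..x})"
        using Lim_emeasure_decseq[of D \<mu>] Lim_emeasure_decseq[of D \<nu>] D dec sets by simp_all
      then show ?thesis by (rule LIMSEQ_unique)
    qed
    \<comment> \<open>The density \<open>indicator C\<close> restricts both measures to
      \<open>C\<close> but keeps \<open>UNIV\<close> as their space, where the lower boxes generate
      the Borel sets.\<close>
    have "density \<mu> (indicator C) = density \<nu> (indicator C)"
    proof (rule measure_eqI_generator_eq[where E = "range (\<lambda>a :: real ^ 'd. {..a})" and \<Omega> = UNIV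
          and A = "\<lambda>i. {..(\<chi> j. real i)}"])
      show "Int_stable (range (\<lambda>a :: real ^ 'd. {..a}))"
      proof (rule Int_stableI_image)
        fix x y :: "real ^ 'd"
        have "{..x} \<inter> {..y} = {..(\<chi> j. min (x $ j) (y $ j))}"
          by (auto simp: less_eq_vec_def)
        then show "\<exists>z\<in>UNIV. {..x} \<inter> {..y} = {..z}" by blast
      qed
      show "sets (density \<mu> (indicator C)) = sigma_sets UNIV (range (\<lambda>a :: real ^ 'd. {..a}))"
        "sets (density \<nu> (indicator C)) = sigma_sets UNIV (range (\<lambda>a :: real ^ 'd. {..a}))"
        using sets by (simp_all add: borel_eq_atMost)
      show "(\<Union>i. {..(\<chi> j. real i) :: real ^ 'd}) = UNIV"
      proof -
        have "\<exists>i. x \<le> (\<chi> j. real i)" for x :: "real ^ 'd"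
        proof -
          obtain i where "norm x \<le> real i" using real_arch_simple by blast
          then have "x $ j \<le> real i" for j using component_le_norm_cart[of x j] by linarith
          then show ?thesis by (auto simp: less_eq_vec_def)
        qed
        then show ?thesis by auto
      qed
      show "emeasure (density \<mu> (indicator C)) X = emeasure (density \<nu> (indicator C)) X"
        if "X \<in> range (\<lambda>a :: real ^ 'd. {..a})" for X
        using that all by (auto simp: emeasure_restricted sets Int_commute)
      show "emeasure (density \<mu> (indicator C)) {..(\<chi> j. real i)} \<noteq> \<infinity>" for i
        using emeasure_mono[of "C \<inter> {..(\<chi> j. real i)}" C \<mu>] fin[OF c] unfolding C_def[symmetric]
        by (auto simp: emeasure_restricted sets top_unique)
    qed auto
    then have "emeasure (density \<mu> (indicator C)) B = emeasure (density \<nu> (indicator C)) B" by simp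
    then show ?thesis by (simp add: emeasure_restricted sets Int_commute C_def)
  qed
  \<comment> \<open>The removed boxes shrink to the origin, so the pieces of \<open>A\<close>
    increase to \<open>A\<close>.\<close>
  define C where "C m = A \<inter> (\<bbbE> - {..(\<chi> j. 1 / real (Suc m)) :: real ^ 'd})" for m
  have C: "range C \<subseteq> sets borel"
    unfolding C_def using A(1) by (intro image_subsetI sets.Int sets.Diff punctured_orthant_borel atMost_vec_borel)
  have inc: "incseq C"
  proof (rule incseq_SucI)
    fix m
    have "1 / real (Suc (Suc m)) \<le> 1 / real (Suc m)" by (simp add: field_simps)
    then have "(\<chi> j. 1 / real (Suc (Suc m))) \<le> ((\<chi> j. 1 / real (Suc m)) :: real ^ 'd)"
      by (simp add: less_eq_vec_def)
    then show "C m \<subseteq> C (Suc m)"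
      unfolding C_def by (auto intro: order_trans)
  qed
  have "(\<Union>m. C m) = A"
    using A(2) punctured_orthant_UN[where 'd = 'd] unfolding C_def by blast
  moreover have "emeasure \<mu> (C m) = emeasure \<nu> (C m)" for m
    unfolding C_def using A by (intro key) auto
  ultimately have "(\<lambda>m. emeasure \<mu> (C m)) \<longlonglongrightarrow> emeasure \<mu> A" "(\<lambda>m. emeasure \<mu> (C m)) \<longlonglongrightarrow> emeasure \<nu> A"
    using Lim_emeasure_incseq[of C \<mu>] Lim_emeasure_incseq[of C \<nu>] C inc sets by simp_all
  then show ?thesis by (rule LIMSEQ_unique)
qed

section \<open>Measures generated by random rays\<close>

text \<open>
  All of \<open>lborel\<close> can be used instead of its restriction to \<open>s > 0\<close>: if \<open>V \<ge> 0\<close>, the \<open>s \<le> 0\<close> contribute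
  nothing on \<open>\<bbbE>\<close>, with the junk value \<open>V / 0 = 0\<close>.
\<close>

definition ray_measure :: "'b measure \<Rightarrow> ('b \<Rightarrow> real ^ 'd) \<Rightarrow> (real ^ 'd) measure" where
  "ray_measure M V = distr (M \<Otimes>\<^sub>M lborel) borel (\<lambda>(\<omega>, s). V \<omega> /\<^sub>R s)"

lemma sets_ray_measure [simp]: "sets (ray_measure M V) = sets borel"
  by (simp add: ray_measure_def)

text \<open>Tonelli's theorem: the mass is the mean length of the sections in \<open>s\<close>.
  Measurability of this length is recorded because it allows a vanishing integral to be read as an
  almost sure statement.\<close>

lemma emeasure_ray_measure:
  fixes V :: "'b \<Rightarrow> real ^ 'd"
  assumes [measurable]: "V \<in> borel_measurable M" "A \<in> sets borel"
  shows "emeasure (ray_measure M V) A = (\<integral>\<^sup>+\<omega>. emeasure lborel {s. V \<omega> /\<^sub>R s \<in> A} \<partial>M)"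
    and "(\<lambda>\<omega>. emeasure lborel {s. V \<omega> /\<^sub>R s \<in> A}) \<in> borel_measurable M"
proof -
  define X where "X = (\<lambda>(\<omega>, s). V \<omega> /\<^sub>R s) -` A \<inter> space (M \<Otimes>\<^sub>M lborel)"
  have X: "X \<in> sets (M \<Otimes>\<^sub>M lborel)" unfolding X_def by measurable
  have sec: "Pair \<omega> -` X = {s. V \<omega> /\<^sub>R s \<in> A}" if "\<omega> \<in> space M" for \<omega>
    using that by (auto simp: X_def space_pair_measure)
  have "emeasure (ray_measure M V) A = emeasure (M \<Otimes>\<^sub>M lborel) X"
    unfolding ray_measure_def X_def by (rule emeasure_distr) measurable
  also have "\<dots> = (\<integral>\<^sup>+\<omega>. emeasure lborel (Pair \<omega> -` X) \<partial>M)"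
    by (rule lborel.emeasure_pair_measure_alt[OF X])
  also have "\<dots> = (\<integral>\<^sup>+\<omega>. emeasure lborel {s. V \<omega> /\<^sub>R s \<in> A} \<partial>M)"
    by (rule nn_integral_cong) (simp add: sec)
  finally show "emeasure (ray_measure M V) A = (\<integral>\<^sup>+\<omega>. emeasure lborel {s. V \<omega> /\<^sub>R s \<in> A} \<partial>M)" .
  show "(\<lambda>\<omega>. emeasure lborel {s. V \<omega> /\<^sub>R s \<in> A}) \<in> borel_measurable M"
    using lborel.measurable_emeasure_Pair[OF X] by (simp add: sec cong: measurable_cong)
qed

text \<open>For fixed \<open>\<omega>\<close> the ray point at \<open>s > 0\<close> is outside the
  box exactly if \<open>s\<close> is below the largest ratio of a coordinate of
  \<open>V \<omega>\<close> to that of \<open>x\<close>. The section is thus an interval of that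
  length, and its mean is the expectation in the formula for \<open>stdf\<close> at the reciprocal
  of \<open>x\<close>.\<close>

lemma ray_measure_box_complement:
  fixes V :: "'b \<Rightarrow> real ^ 'd"
  assumes [measurable]: "V \<in> borel_measurable M" and V0: "\<And>\<omega> j. 0 \<le> V \<omega> $ j"
    and int: "\<And>j. integrable M (\<lambda>\<omega>. V \<omega> $ j)" and x: "\<And>j. 0 < x $ j"
  shows "emeasure (ray_measure M V) (\<bbbE> - {..x}) = ennreal (\<integral>\<omega>. Max (range (\<lambda>j. V \<omega> $ j / x $ j)) \<partial>M)"
proof -
  have [measurable]: "(\<lambda>\<omega>. V \<omega> $ j) \<in> borel_measurable M" for j
    using borel_measurable_vec_iff assms(1) by blast
  define W where "W \<omega> = Max (range (\<lambda>j. V \<omega> $ j / x $ j))" for \<omega>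
  have W0: "0 \<le> W \<omega>" for \<omega>
    unfolding W_def using divide_nonneg_pos[OF V0 x] by (subst Max_ge_iff) auto
  have Wm: "W \<in> borel_measurable M"
    unfolding W_def using borel_measurable_Max[of "UNIV :: 'd set" "\<lambda>j \<omega>. V \<omega> $ j / x $ j" M]
    by simp
  \<comment> \<open>The maximum of the nonnegative ratios is at most their sum.\<close>
  have "integrable M W"
  proof (rule Bochner_Integration.integrable_bound)
    show "integrable M (\<lambda>\<omega>. \<Sum>j\<in>UNIV. V \<omega> $ j / x $ j)" using int by simp
    have "W \<omega> \<le> (\<Sum>j\<in>UNIV. V \<omega> $ j / x $ j)" for \<omega>
      unfolding W_def
    proof (rule Max.boundedI)
      fix a assume "a \<in> range (\<lambda>j. V \<omega> $ j / x $ j)"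
      then show "a \<le> (\<Sum>j\<in>UNIV. V \<omega> $ j / x $ j)"
        using V0 x by (auto intro!: member_le_sum simp: less_imp_le)
    qed auto
    then show "AE \<omega> in M. norm (W \<omega>) \<le> norm (\<Sum>j\<in>UNIV. V \<omega> $ j / x $ j)"
      unfolding real_norm_def abs_of_nonneg[OF W0] by (intro AE_I2 order_trans[OF _ abs_ge_self])
  qed (rule Wm)
  have sec: "{s. V \<omega> /\<^sub>R s \<in> \<bbbE> - {..x}} = {0<..<W \<omega>}" for \<omega>
  proof (intro set_eqI iffI)
    fix s assume s: "s \<in> {s. V \<omega> /\<^sub>R s \<in> \<bbbE> - {..x}}"
    then obtain j where j: "x $ j < V \<omega> $ j / s"
      by (auto simp: less_eq_vec_def not_le divide_inverse mult.commute)
    have "0 < s"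
    proof (rule ccontr)
      assume "\<not> 0 < s"
      then have "V \<omega> $ j / s \<le> 0" using V0[of \<omega> j] by (simp add: divide_nonneg_nonpos)
      then show False using j x[of j] by linarith
    qed
    then have "s < V \<omega> $ j / x $ j" using j x[of j] by (simp add: field_simps)
    then show "s \<in> {0<..<W \<omega>}" using \<open>0 < s\<close> unfolding W_def by (auto simp: Max_gr_iff)
  next
    fix s assume s: "s \<in> {0<..<W \<omega>}"
    then obtain j where "s < V \<omega> $ j / x $ j" unfolding W_def by (auto simp: Max_gr_iff)
    then have j: "x $ j < V \<omega> $ j / s" using x[of j] s by (simp add: field_simps)
    then have "0 < (V \<omega> /\<^sub>R s) $ j" using x[of j] by (simp add: divide_inverse mult.commute)
    then have "V \<omega> /\<^sub>R s \<noteq> 0" by (metis less_irrefl zero_index)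
    moreover have "0 \<le> (V \<omega> /\<^sub>R s) $ i" for i using V0[of \<omega> i] s by simp
    moreover have "\<not> V \<omega> /\<^sub>R s \<le> x"
      using j by (auto simp: less_eq_vec_def not_le divide_inverse mult.commute)
    ultimately show "s \<in> {s. V \<omega> /\<^sub>R s \<in> \<bbbE> - {..x}}" by (simp add: punctured_orthant_def)
  qed
  have "emeasure (ray_measure M V) (\<bbbE> - {..x}) = (\<integral>\<^sup>+\<omega>. ennreal (W \<omega>) \<partial>M)"
    by (subst emeasure_ray_measure) (simp_all only: sec emeasure_lborel_Ioo[OF W0] diff_zero, measurable)
  also have "\<dots> = ennreal (\<integral>\<omega>. W \<omega> \<partial>M)"
    using \<open>integrable M W\<close> W0 by (intro nn_integral_eq_integral) auto
  finally show ?thesis by (simp add: W_def)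
qed

section \<open>The exponent measure\<close>

text \<open>Infinite values for all coordinates but the \<open>j\<close>-th turn the joint
  distribution function into a Frechet margin, which is positive at \<open>c\<close>; infinite mass
  would make it \<open>eexp (- \<infinity>) = 0\<close>.\<close>

lemma exponent_measure_halfspace:
  fixes G \<mu> :: "(real ^ 'd) measure"
  assumes G: "sets G = sets borel" "unit_frechet_margins G" and \<mu>: "exponent_measure G \<mu>" and c: "0 < c"
  shows "emeasure \<mu> {y \<in> \<bbbE>. c < y $ j} \<noteq> \<infinity>"
proof
  assume inf: "emeasure \<mu> {y \<in> \<bbbE>. c < y $ j} = \<infinity>"
  define x where "x i = (if i = j then ereal c else \<infinity>)" for i
  have box: "{y :: real ^ 'd. \<forall>i. ereal (y $ i) \<le> x i} = {y. y $ j \<le> c}"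
    by (auto simp: x_def)
  have "joint_cdf G x = cdf (marginal G j) c"
    unfolding joint_cdf_def box cdf_def marginal_def using G(1)
    by (subst measure_distr) (auto simp: vimage_def sets_eq_imp_space_eq[OF G(1)] cong: measurable_cong_sets)
  also have "\<dots> = exp (- 1 / c)" using G(2) c by (simp add: unit_frechet_margins_def)
  finally have 1: "joint_cdf G x > 0" by simp
  have "\<bbbE> - {y. y $ j \<le> c} = {y \<in> \<bbbE>. c < y $ j}" by auto
  moreover have "\<forall>i. 0 \<le> x i" using c by (auto simp: x_def)
  then have "joint_cdf G x = eexp (- enn2ereal (emeasure \<mu> (\<bbbE> - {y. \<forall>i. ereal (y $ i) \<le> x i})))"
    using \<mu> unfolding exponent_measure_def by blast
  ultimately have "joint_cdf G x = eexp (- enn2ereal (emeasure \<mu> {y \<in> \<bbbE>. c < y $ j}))"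
    unfolding box by simp
  with 1 show False by (simp add: inf eexp_def)
qed

text \<open>A box complement is a finite union of half-spaces, each of finite mass.\<close>

lemma exponent_measure_box_complement_finite:
  fixes G \<mu> :: "(real ^ 'd) measure"
  assumes G: "sets G = sets borel" "unit_frechet_margins G" and \<mu>: "exponent_measure G \<mu>"
    and x: "\<And>j. 0 < x $ j"
  shows "emeasure \<mu> (\<bbbE> - {..x}) \<noteq> \<infinity>"
proof -
  have sets: "sets \<mu> = sets borel" using \<mu> by (simp add: exponent_measure_def)
  have m: "{y \<in> \<bbbE>. x $ j < y $ j} \<in> sets \<mu>" for j
    unfolding sets by measurable
  have "emeasure \<mu> (\<bbbE> - {..x}) = emeasure \<mu> (\<Union>j. {y \<in> \<bbbE>. x $ j < y $ j})"
    by (rule arg_cong[where f = "emeasure \<mu>"]) (auto simp: less_eq_vec_def simp flip: not_le)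
  also have "\<dots> \<le> (\<Sum>j\<in>UNIV. emeasure \<mu> {y \<in> \<bbbE>. x $ j < y $ j})"
    using m by (intro emeasure_subadditive_finite) auto
  also have "\<dots> < \<infinity>"
    using exponent_measure_halfspace[OF G \<mu> x] by (simp add: less_top)
  finally show ?thesis by simp
qed

text \<open>The logarithm undoes the exponential in \<open>exponent_measure\<close>. Finiteness
  matters here: for infinite mass the convention \<open>ln 0 = 0\<close> would give
  \<open>stdf\<close> the value 0.\<close>

lemma exponent_measure_box_complement:
  fixes G \<mu> :: "(real ^ 'd) measure"
  assumes G: "sets G = sets borel" "unit_frechet_margins G" and \<mu>: "exponent_measure G \<mu>"
    and x: "\<And>j. 0 < x $ j"
  shows "emeasure \<mu> (\<bbbE> - {..x}) = ennreal (stdf G (\<chi> j. 1 / x $ j))"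
proof -
  define m where "m = emeasure \<mu> (\<bbbE> - {..x})"
  have m: "m \<noteq> \<infinity>" unfolding m_def by (rule exponent_measure_box_complement_finite[OF G \<mu> x])
  have inv: "1 / ereal ((\<chi> j. 1 / x $ j) $ j) = ereal (x $ j)" for j
    using x[of j] by (simp add: one_ereal_def)
  have "joint_cdf G (\<lambda>j. ereal (x $ j)) = eexp (- enn2ereal (emeasure \<mu> (\<bbbE> - {y. \<forall>j. ereal (y $ j) \<le> ereal (x $ j)})))"
    using \<mu> less_imp_le[OF x] unfolding exponent_measure_def
    by (elim conjE allE[of _ "\<lambda>j. ereal (x $ j)"]) simp
  also have "{y :: real ^ 'd. \<forall>j. ereal (y $ j) \<le> ereal (x $ j)} = {..x}"
    by (auto simp: less_eq_vec_def)
  finally have "joint_cdf G (\<lambda>j. ereal (x $ j)) = eexp (- enn2ereal m)" by (simp add: m_def)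
  then have "stdf G (\<chi> j. 1 / x $ j) = - ln (eexp (- enn2ereal m))"
    unfolding stdf_def inv by simp
  also have "\<dots> = enn2real m"
    using m by (cases m) (auto simp: eexp_def)
  finally show ?thesis using m by (simp add: m_def less_top)
qed

text \<open>The two measures have the same finite masses on complements of boxes with positive
  corners, which determine a measure on \<open>\<bbbE>\<close>. This is how the generators
  enter.\<close>

lemma exponent_measure_eq_ray_measure:
  fixes G \<mu> :: "(real ^ 'd) measure"
  assumes G: "sets G = sets borel" "unit_frechet_margins G" and \<mu>: "exponent_measure G \<mu>"
    and V: "V \<in> borel_measurable M" "\<And>\<omega> j. 0 \<le> V \<omega> $ j" "\<And>j. integrable M (\<lambda>\<omega>. V \<omega> $ j)"
    and stdf: "\<And>y. (\<And>j. 0 \<le> y $ j) \<Longrightarrow> stdf G y = (\<integral>\<omega>. Max (range (\<lambda>j. y $ j * V \<omega> $ j)) \<partial>M)"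
    and A: "A \<in> sets borel" "A \<subseteq> \<bbbE>"
  shows "emeasure \<mu> A = emeasure (ray_measure M V) A"
proof (rule measure_eq_on_orthant[OF _ _ _ _ A])
  fix x :: "real ^ 'd" assume x: "\<And>j. 0 < x $ j"
  show "emeasure \<mu> (\<bbbE> - {..x}) \<noteq> \<infinity>"
    by (rule exponent_measure_box_complement_finite[OF G \<mu> x])
  show "emeasure \<mu> (\<bbbE> - {..x}) = emeasure (ray_measure M V) (\<bbbE> - {..x})"
    using x unfolding exponent_measure_box_complement[OF G \<mu> x] ray_measure_box_complement[OF V x]
    by (subst stdf) (simp_all add: less_imp_le)
qed (use \<mu> in \<open>simp_all add: exponent_measure_def\<close>)

text \<open>Countable sections have length zero. This applies to surfaces that every ray crosses at
  only a few parameters.\<close>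

lemma ray_measure_null:
  fixes V :: "'b \<Rightarrow> real ^ 'd"
  assumes "V \<in> borel_measurable M" "A \<in> sets borel" "\<And>v. countable {s. v /\<^sub>R s \<in> A}"
  shows "emeasure (ray_measure M V) A = 0"
  using assms by (simp add: emeasure_ray_measure emeasure_lborel_countable)

text \<open>If \<open>V \<omega>\<close> lies in the face, its section contains an interval
  \<open>{0<..<r}\<close> and has positive length; otherwise the section is empty. The mean length
  is therefore positive exactly if \<open>V\<close> lies in the face with positive
  probability.\<close>

lemma ray_measure_face_pos_iff:
  fixes V :: "'b \<Rightarrow> real ^ 'd"
  assumes M: "finite_measure M"
    and V [measurable]: "V \<in> borel_measurable M" and V0: "\<And>\<omega> j. 0 \<le> V \<omega> $ j" and J: "J \<noteq> {}"
    and A [measurable]: "A \<in> sets borel" and sub: "A \<subseteq> face J"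
    and ray: "\<And>v. v \<in> face J \<Longrightarrow> \<exists>r>0. \<forall>s. 0 < s \<and> s < r \<longrightarrow> v /\<^sub>R s \<in> A"
  shows "0 < emeasure (ray_measure M V) A \<longleftrightarrow> 0 < measure M {\<omega> \<in> space M. \<forall>j. 0 < V \<omega> $ j \<longleftrightarrow> j \<in> J}"
proof -
  interpret finite_measure M by fact
  have inner: "emeasure lborel {s. V \<omega> /\<^sub>R s \<in> A} = 0 \<longleftrightarrow> V \<omega> \<notin> face J" for \<omega>
  proof
    assume 0: "emeasure lborel {s. V \<omega> /\<^sub>R s \<in> A} = 0"
    show "V \<omega> \<notin> face J"
    proof
      assume "V \<omega> \<in> face J"
      then obtain r where r: "0 < r" "\<And>s. 0 < s \<and> s < r \<Longrightarrow> V \<omega> /\<^sub>R s \<in> A" using ray by blast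
      have "{s. V \<omega> /\<^sub>R s \<in> A} = (\<lambda>s. V \<omega> /\<^sub>R s) -` A \<inter> space borel" by auto
      also have "\<dots> \<in> sets borel" by measurable
      finally have "emeasure lborel {0<..<r} \<le> emeasure lborel {s. V \<omega> /\<^sub>R s \<in> A}"
        using r by (intro emeasure_mono) auto
      with 0 r(1) show False by simp
    qed
  next
    assume no: "V \<omega> \<notin> face J"
    have "V \<omega> /\<^sub>R s \<notin> A" for s
    proof
      assume "V \<omega> /\<^sub>R s \<in> A"
      then have f: "\<And>j. 0 < (V \<omega> /\<^sub>R s) $ j \<longleftrightarrow> j \<in> J" using sub by (auto simp: face_def)
      \<comment> \<open>Since \<open>J\<close> is nonempty, some coordinate of the ray point is
        positive, which excludes \<open>s \<le> 0\<close>.\<close>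
      obtain i where "0 < inverse s * V \<omega> $ i" using J f by fastforce
      then have "0 < s" using V0[of \<omega> i] by (auto simp: zero_less_mult_iff)
      then have "\<forall>j. 0 < V \<omega> $ j \<longleftrightarrow> j \<in> J" using f by (simp add: zero_less_mult_iff)
      with no show False using face_iff[OF J V0] by blast
    qed
    then show "emeasure lborel {s. V \<omega> /\<^sub>R s \<in> A} = 0" by simp
  qed
  have "emeasure (ray_measure M V) A = 0 \<longleftrightarrow> (AE \<omega> in M. V \<omega> \<notin> face J)"
    using emeasure_ray_measure[OF V A] by (simp add: nn_integral_0_iff_AE inner)
  also have "\<dots> \<longleftrightarrow> emeasure M {\<omega> \<in> space M. V \<omega> \<in> face J} = 0"
    by (subst AE_iff_measurable[OF _ refl]) auto
  also have "\<dots> \<longleftrightarrow> measure M {\<omega> \<in> space M. V \<omega> \<in> face J} = 0"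
    by (simp add: emeasure_eq_measure)
  also have "{\<omega> \<in> space M. V \<omega> \<in> face J} = {\<omega> \<in> space M. \<forall>j. 0 < V \<omega> $ j \<longleftrightarrow> j \<in> J}"
    using face_iff[OF J V0] by blast
  finally show ?thesis by (simp add: zero_less_iff_neq_zero zero_less_measure_iff)
qed

section \<open>Norms\<close>

lemma vector_norm_scale: "vector_norm N \<Longrightarrow> N (c *\<^sub>R x) = \<bar>c\<bar> * N x"
  by (simp add: vector_norm_def)

lemma vector_norm_pos: "vector_norm N \<Longrightarrow> x \<noteq> 0 \<Longrightarrow> 0 < N x"
  by (simp add: vector_norm_def less_le)

text \<open>The triangle inequality and homogeneity make \<open>N\<close> convex, and a real-valued
  convex function on the whole of a Euclidean space is continuous.\<close>

lemma continuous_on_vector_norm: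
  assumes "vector_norm N"
  shows "continuous_on UNIV N"
proof (rule convex_on_continuous)
  show "convex_on UNIV N"
  proof (rule convex_onI)
    fix t :: real and x y :: "real ^ 'a" assume t: "0 < t" "t < 1"
    have "N ((1 - t) *\<^sub>R x + t *\<^sub>R y) \<le> N ((1 - t) *\<^sub>R x) + N (t *\<^sub>R y)"
      using assms unfolding vector_norm_def by blast
    then show "N ((1 - t) *\<^sub>R x + t *\<^sub>R y) \<le> (1 - t) * N x + t * N y"
      using t by (simp add: vector_norm_scale[OF assms])
  qed simp
qed simp

text \<open>By continuity \<open>N\<close> is below 1 near the origin. The inclusion transfers
  finiteness of the mass from box complements to \<open>{x \<in> \<bbbE>. 1 < N x}\<close>.\<close>

lemma vector_norm_gt_1_bounded_away:
  fixes N :: "real ^ 'd \<Rightarrow> real"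
  assumes N: "vector_norm N"
  obtains \<delta> where "0 < \<delta>" "{x \<in> \<bbbE>. 1 < N x} \<subseteq> \<bbbE> - {..\<chi> j. \<delta>}"
proof -
  have "N 0 = 0" using N by (simp add: vector_norm_def)
  moreover have "open (N -` {..<1})"
    using continuous_on_vector_norm[OF N] by (rule open_vimage[rotated]) simp
  ultimately obtain e where e: "0 < e" "ball 0 e \<subseteq> N -` {..<1}"
    by (metis lessThan_iff openE vimageI zero_less_one)
  \<comment> \<open>With this choice \<open>CARD('d)\<close> coordinates of size at most
    \<open>\<delta>\<close> sum to at most \<open>e / 2\<close>, and this sum bounds the Euclidean
    norm.\<close>
  define \<delta> where "\<delta> = e / (2 * real CARD('d))"
  have "0 < \<delta>" using e by (simp add: \<delta>_def)
  moreover have "\<not> x \<le> (\<chi> j. \<delta>)" if x: "x \<in> \<bbbE>" "1 < N x" for x :: "real ^ 'd"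
  proof
    assume "x \<le> (\<chi> j. \<delta>)"
    then have "(\<Sum>j\<in>UNIV. \<bar>x $ j\<bar>) \<le> (\<Sum>j\<in>(UNIV :: 'd set). \<delta>)"
      using x by (intro sum_mono) (auto simp: punctured_orthant_def less_eq_vec_def)
    also have "\<dots> = e / 2" by (simp add: \<delta>_def)
    finally have "norm x < e" using norm_le_l1_cart[of x] e(1) by linarith
    then have "x \<in> N -` {..<1}" using e(2) by (intro subsetD[OF e(2)]) simp
    with x(2) show False by simp
  qed
  ultimately show ?thesis using that by blast
qed

section \<open>Neighbourhoods of faces\<close>

text \<open>Common form of both regions at scale 1: \<open>h j x\<close> is \<open>x $ j\<close> for
  rectangles and \<open>x $ j / N x\<close> for cones. The thresholds \<open>a\<close> and
  \<open>b\<close> are separate so that a cone can be enclosed between two such sets.\<close>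

definition face_nbhd ::
  "(real ^ 'd \<Rightarrow> real) \<Rightarrow> ('d \<Rightarrow> real ^ 'd \<Rightarrow> real) \<Rightarrow> 'd set \<Rightarrow> real \<Rightarrow> real \<Rightarrow> (real ^ 'd) set" where
  "face_nbhd N h J a b = {x \<in> \<bbbE>. 1 < N x \<and> (\<forall>j\<in>J. a < h j x) \<and> (\<forall>j\<in>-J. h j x \<le> b)}"

lemma face_nbhd_borel:
  assumes [measurable]: "N \<in> borel_measurable borel" "\<And>j. h j \<in> borel_measurable borel"
  shows "face_nbhd N h J a b \<in> sets borel"
  unfolding face_nbhd_def by measurable

text \<open>The set \<open>W\<close> with strict inequalities is relatively open, the set
  \<open>Z\<close> with weak ones is relatively closed, and the neighbourhood lies between them. A
  point of \<open>Z - W\<close> satisfies one of the inequalities with equality.\<close>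

lemma frontier_face_nbhd:
  fixes N :: "real ^ 'd \<Rightarrow> real"
  assumes N: "continuous_on \<bbbE> N" and h: "\<And>j. continuous_on \<bbbE> (h j)"
  shows "top_of_set \<bbbE> frontier_of face_nbhd N h J a b
    \<subseteq> {x \<in> \<bbbE>. N x = 1} \<union> (\<Union>j. {x \<in> \<bbbE>. 1 < N x \<and> h j x = a}) \<union> (\<Union>j. {x \<in> \<bbbE>. 1 < N x \<and> h j x = b})"
proof -
  define W where "W = {x \<in> \<bbbE>. 1 < N x \<and> (\<forall>j\<in>J. a < h j x) \<and> (\<forall>j\<in>-J. h j x < b)}"
  define Z where "Z = {x \<in> \<bbbE>. 1 \<le> N x \<and> (\<forall>j\<in>J. a \<le> h j x) \<and> (\<forall>j\<in>-J. h j x \<le> b)}"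
  have op: "openin (top_of_set \<bbbE>) (\<bbbE> \<inter> f -` T)" if "continuous_on \<bbbE> f" "open T" for f :: "real ^ 'd \<Rightarrow> real" and T
    using that continuous_openin_preimage_gen by blast
  have cl: "closedin (top_of_set \<bbbE>) (\<bbbE> \<inter> f -` T)" if "continuous_on \<bbbE> f" "closed T" for f :: "real ^ 'd \<Rightarrow> real" and T
    using that continuous_closedin_preimage by blast
  have "openin (top_of_set \<bbbE>) (\<bbbE> \<inter> N -` {1<..})" by (intro op N) auto
  \<comment> \<open>The outer intersection with \<open>\<bbbE>\<close> takes care of an empty index
    set, whose intersection is \<open>UNIV\<close>.\<close>
  moreover have "openin (top_of_set \<bbbE>) (\<bbbE> \<inter> (\<Inter>j\<in>J. \<bbbE> \<inter> h j -` {a<..}))"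
    using openin_INT[of J "top_of_set \<bbbE>" "\<lambda>j. \<bbbE> \<inter> h j -` {a<..}"] op[OF h, of "{a<..}"]
    by (simp add: Int_commute)
  moreover have "openin (top_of_set \<bbbE>) (\<bbbE> \<inter> (\<Inter>j\<in>-J. \<bbbE> \<inter> h j -` {..<b}))"
    using openin_INT[of "-J" "top_of_set \<bbbE>" "\<lambda>j. \<bbbE> \<inter> h j -` {..<b}"] op[OF h, of "{..<b}"]
    by (simp add: Int_commute)
  ultimately have "openin (top_of_set \<bbbE>)
     ((\<bbbE> \<inter> N -` {1<..}) \<inter> (\<bbbE> \<inter> (\<Inter>j\<in>J. \<bbbE> \<inter> h j -` {a<..})) \<inter> (\<bbbE> \<inter> (\<Inter>j\<in>-J. \<bbbE> \<inter> h j -` {..<b})))"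
    by (rule openin_Int[OF openin_Int])
  also have "(\<bbbE> \<inter> N -` {1<..}) \<inter> (\<bbbE> \<inter> (\<Inter>j\<in>J. \<bbbE> \<inter> h j -` {a<..})) \<inter> (\<bbbE> \<inter> (\<Inter>j\<in>-J. \<bbbE> \<inter> h j -` {..<b})) = W"
    by (auto simp: W_def)
  finally have W: "W \<subseteq> top_of_set \<bbbE> interior_of face_nbhd N h J a b"
    by (rule interior_of_maximal[rotated]) (unfold W_def face_nbhd_def, blast intro: less_imp_le)
  have "closedin (top_of_set \<bbbE>) (\<Inter>(insert (\<bbbE> \<inter> N -` {1..}) ((\<lambda>j. \<bbbE> \<inter> h j -` {a..}) ` J \<union> (\<lambda>j. \<bbbE> \<inter> h j -` {..b}) ` (- J))))"
    by (intro closedin_Inter) (use N h in \<open>auto intro: cl\<close>)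
  also have "\<Inter>(insert (\<bbbE> \<inter> N -` {1..}) ((\<lambda>j. \<bbbE> \<inter> h j -` {a..}) ` J \<union> (\<lambda>j. \<bbbE> \<inter> h j -` {..b}) ` (- J))) = Z"
    by (auto simp: Z_def)
  finally have "top_of_set \<bbbE> closure_of face_nbhd N h J a b \<subseteq> Z"
    by (rule closure_of_minimal[rotated]) (unfold Z_def face_nbhd_def, blast intro: less_imp_le)
  with W have "top_of_set \<bbbE> frontier_of face_nbhd N h J a b \<subseteq> Z - W"
    by (auto simp: frontier_of_def)
  also have "Z - W \<subseteq> {x \<in> \<bbbE>. N x = 1} \<union> (\<Union>j. {x \<in> \<bbbE>. 1 < N x \<and> h j x = a}) \<union> (\<Union>j. {x \<in> \<bbbE>. 1 < N x \<and> h j x = b})"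
  proof
    fix x assume x: "x \<in> Z - W"
    show "x \<in> {x \<in> \<bbbE>. N x = 1} \<union> (\<Union>j. {x \<in> \<bbbE>. 1 < N x \<and> h j x = a}) \<union> (\<Union>j. {x \<in> \<bbbE>. 1 < N x \<and> h j x = b})"
    proof (rule ccontr)
      assume no: "\<not> ?thesis"
      then have "N x \<noteq> 1" using x by (auto simp: Z_def)
      then have N1: "1 < N x" using x by (auto simp: Z_def)
      then have ne: "a \<noteq> h j x" "h j x \<noteq> b" for j using no x by (auto simp: Z_def)
      have "x \<in> W" using x N1 ne by (simp add: W_def Z_def less_le)
      with x show False by simp
    qed
  qed
  finally show ?thesis .
qed

text \<open>The sets need not be monotone in \<open>\<epsilon>\<close>: lowering \<open>a\<close>
  enlarges them and lowering \<open>b\<close> shrinks them. But each point is eventually classified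
  as at thresholds 0, so dominated convergence applies, with the indicator of
  \<open>{x \<in> \<bbbE>. 1 < N x}\<close> as bound.\<close>

lemma face_nbhd_tendsto:
  fixes \<mu> :: "(real ^ 'd) measure" and a b :: "real \<Rightarrow> real"
  assumes sets: "sets \<mu> = sets borel" and fin: "emeasure \<mu> {x \<in> \<bbbE>. 1 < N x} \<noteq> \<infinity>"
    and meas [measurable]: "N \<in> borel_measurable borel" "\<And>j. h j \<in> borel_measurable borel"
    and a: "(a \<longlongrightarrow> 0) (at_right 0)" "\<And>\<epsilon>. 0 < \<epsilon> \<Longrightarrow> 0 \<le> a \<epsilon>"
    and b: "(b \<longlongrightarrow> 0) (at_right 0)" "\<And>\<epsilon>. 0 < \<epsilon> \<Longrightarrow> 0 \<le> b \<epsilon>"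
  shows "((\<lambda>\<epsilon>. measure \<mu> (face_nbhd N h J (a \<epsilon>) (b \<epsilon>))) \<longlongrightarrow> measure \<mu> (face_nbhd N h J 0 0)) (at_right 0)"
  unfolding tendsto_at_iff_sequentially o_def
proof (intro allI impI)
  fix e :: "nat \<Rightarrow> real" assume e: "\<forall>i. e i \<in> {0<..} - {0}" "e \<longlonglongrightarrow> 0"
  define A where "A n = face_nbhd N h J (a (e n)) (b (e n))" for n
  define L where "L = face_nbhd N h J 0 0"
  have lim: "filterlim e (at_right 0) sequentially"
  proof -
    have "e i \<noteq> 0" for i using e(1) by (metis DiffD2 singletonI)
    then show ?thesis using e by (simp add: filterlim_at)
  qed
  have ae: "(\<lambda>n. a (e n)) \<longlonglongrightarrow> 0" and be: "(\<lambda>n. b (e n)) \<longlonglongrightarrow> 0"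
    using filterlim_compose[OF a(1) lim] filterlim_compose[OF b(1) lim] .
  have e0: "0 \<le> a (e n)" "0 \<le> b (e n)" for n using e(1) a(2) b(2) by auto
  have [measurable]: "A n \<in> sets \<mu>" "L \<in> sets \<mu>" "{x \<in> \<bbbE>. 1 < N x} \<in> sets \<mu>" for n
    unfolding sets A_def L_def using face_nbhd_borel[OF meas] by simp_all measurable
  have "(\<lambda>n. \<integral>x. indicator (A n) x \<partial>\<mu>) \<longlonglongrightarrow> (\<integral>x. (indicator L x :: real) \<partial>\<mu>)"
  proof (rule integral_dominated_convergence[where w = "indicator {x \<in> \<bbbE>. 1 < N x}"])
    show "integrable \<mu> (indicator {x \<in> \<bbbE>. 1 < N x} :: _ \<Rightarrow> real)"
      using fin by (simp add: integrable_indicator_iff less_top)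
    show "AE x in \<mu>. (\<lambda>n. indicator (A n) x) \<longlonglongrightarrow> (indicator L x :: real)"
    proof (intro AE_I2 tendsto_eventually)
      fix x
      have 1: "\<forall>\<^sub>F n in sequentially. a (e n) < h j x \<longleftrightarrow> 0 < h j x" for j
      proof (cases "0 < h j x")
        case True
        then show ?thesis using order_tendstoD(2)[OF ae True] by simp
      next
        case False
        then have "\<not> a (e n) < h j x" for n using e0(1)[of n] by linarith
        then show ?thesis using False by simp
      qed
      have 2: "\<forall>\<^sub>F n in sequentially. h j x \<le> b (e n) \<longleftrightarrow> h j x \<le> 0" for j
      proof (cases "0 < h j x")
        case True
        then show ?thesis using order_tendstoD(2)[OF be True] by (auto elim: eventually_mono)
      next
        case False
        then have "h j x \<le> b (e n)" for n using e0(2)[of n] by linarith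
        then show ?thesis using False by simp
      qed
      have "\<forall>\<^sub>F n in sequentially. \<forall>j. (a (e n) < h j x \<longleftrightarrow> 0 < h j x) \<and> (h j x \<le> b (e n) \<longleftrightarrow> h j x \<le> 0)"
        by (intro eventually_all_finite eventually_conj 1 2)
      then show "\<forall>\<^sub>F n in sequentially. indicator (A n) x = (indicator L x :: real)"
        by (rule eventually_mono) (simp add: A_def L_def face_nbhd_def indicator_def)
    qed
    show "AE x in \<mu>. norm (indicator (A n) x :: real) \<le> indicator {x \<in> \<bbbE>. 1 < N x} x" for n
      by (intro AE_I2) (auto simp: A_def face_nbhd_def split: split_indicator)
  qed measurable
  then show "(\<lambda>n. measure \<mu> (face_nbhd N h J (a (e n)) (b (e n)))) \<longlonglongrightarrow> measure \<mu> (face_nbhd N h J 0 0)"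
    by (simp add: A_def[symmetric] L_def[symmetric] sets sets_eq_imp_space_eq[OF sets])
qed

text \<open>A finite measure on the line has at most countably many atoms. Those of the image
  measures under all \<open>h j\<close> together still form a countable set, which cannot fill an
  interval.\<close>

lemma exists_null_level:
  fixes h :: "'d :: finite \<Rightarrow> 'a \<Rightarrow> real"
  assumes [measurable]: "\<And>j. h j \<in> borel_measurable \<mu>" "A \<in> sets \<mu>" and fin: "emeasure \<mu> A \<noteq> \<infinity>"
    and "p < q"
  obtains c where "p < c" "c < q" "\<And>j. emeasure \<mu> {x \<in> A. h j x = c} = 0"
proof -
  define \<rho> where "\<rho> j = distr (density \<mu> (indicator A)) borel (h j)" for j
  have hm: "h j \<in> measurable (density \<mu> (indicator A)) borel" for j by simp
  have eq: "emeasure (\<rho> j) C = emeasure \<mu> {x \<in> A. h j x \<in> C}" if "C \<in> sets borel" for j C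
  proof -
    have "emeasure (\<rho> j) C = emeasure (density \<mu> (indicator A)) (h j -` C \<inter> space \<mu>)"
      unfolding \<rho>_def using emeasure_distr[OF hm that] by simp
    also have "\<dots> = emeasure \<mu> (A \<inter> (h j -` C \<inter> space \<mu>))"
      using that by (intro emeasure_restricted) (auto intro: measurable_sets)
    also have "A \<inter> (h j -` C \<inter> space \<mu>) = {x \<in> A. h j x \<in> C}"
      using sets.sets_into_space[OF \<open>A \<in> sets \<mu>\<close>] by auto
    finally show ?thesis .
  qed
  have fm: "finite_measure (\<rho> j)" for j
    using eq[of UNIV j] fin by (intro finite_measureI) (simp add: \<rho>_def)
  have "countable {c. measure (\<rho> j) {c} \<noteq> 0}" for j
    using finite_measure.countable_support[OF fm] .
  then have "countable (\<Union>j. {c. measure (\<rho> j) {c} \<noteq> 0})" by simp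
  moreover have "uncountable {p<..<q}" using \<open>p < q\<close> uncountable_open_interval by blast
  ultimately have "\<not> {p<..<q} \<subseteq> (\<Union>j. {c. measure (\<rho> j) {c} \<noteq> 0})"
    using countable_subset by blast
  then obtain c where "c \<in> {p<..<q}" "c \<notin> (\<Union>j. {c. measure (\<rho> j) {c} \<noteq> 0})" by blast
  then have c: "p < c" "c < q" "\<And>j. measure (\<rho> j) {c} = 0" by auto
  have "emeasure \<mu> {x \<in> A. h j x = c} = 0" for j
    using c(3)[of j] eq[of "{c}" j] finite_measure.emeasure_eq_measure[OF fm] by simp
  with c that show ?thesis by blast
qed

section \<open>Regular variation on neighbourhoods of faces\<close>

lemma mem_scaled_image_iff:
  fixes A :: "(real ^ 'd) set"
  assumes "0 < n"
  shows "x \<in> (\<lambda>x. real n *\<^sub>R x) ` A \<longleftrightarrow> x /\<^sub>R real n \<in> A"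
proof
  assume "x /\<^sub>R real n \<in> A"
  moreover have "x = real n *\<^sub>R (x /\<^sub>R real n)" using assms by simp
  ultimately show "x \<in> (\<lambda>x. real n *\<^sub>R x) ` A" by blast
qed (use assms in auto)

lemma punctured_orthant_scale_iff:
  "0 < c \<Longrightarrow> x /\<^sub>R c \<in> \<bbbE> \<longleftrightarrow> x \<in> \<bbbE>"
  by (auto simp: punctured_orthant_def zero_le_mult_iff)

lemma face_scale_iff:
  "0 < c \<Longrightarrow> x /\<^sub>R c \<in> face J \<longleftrightarrow> x \<in> face J"
  unfolding face_def mem_Collect_eq punctured_orthant_scale_iff by (simp add: zero_less_mult_iff)

lemma scaled_face_nbhd_rectangle:
  assumes "vector_norm N" "0 < n"
  shows "(\<lambda>x. real n *\<^sub>R x) ` face_nbhd N (\<lambda>j x. x $ j) J \<epsilon> \<epsilon> = rectangle_region N \<epsilon> n J"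
proof (rule set_eqI)
  fix x :: "real ^ 'a"
  show "x \<in> (\<lambda>x. real n *\<^sub>R x) ` face_nbhd N (\<lambda>j x. x $ j) J \<epsilon> \<epsilon> \<longleftrightarrow> x \<in> rectangle_region N \<epsilon> n J"
    unfolding mem_scaled_image_iff[OF assms(2)] face_nbhd_def rectangle_region_def mem_Collect_eq
      vector_norm_scale[OF assms(1)]
    using assms(2) punctured_orthant_scale_iff[of "real n" x]
    by (auto simp: field_simps punctured_orthant_def)
qed

text \<open>The quotients \<open>x $ j / N x\<close> are invariant under scaling, so only the
  threshold for the norm changes.\<close>

lemma mem_scaled_face_nbhd_cone_iff:
  assumes N: "vector_norm N" and n: "0 < n"
  shows "x \<in> (\<lambda>x. real n *\<^sub>R x) ` face_nbhd N (\<lambda>j x. x $ j / N x) J a b \<longleftrightarrow>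
    x \<in> \<bbbE> \<and> real n < N x \<and> (\<forall>j\<in>J. a < x $ j / N x) \<and> (\<forall>j\<in>-J. x $ j / N x \<le> b)"
proof -
  have "x /\<^sub>R real n \<in> \<bbbE> \<longleftrightarrow> x \<in> \<bbbE>" using n by (simp add: punctured_orthant_scale_iff)
  moreover have Nn: "N (x /\<^sub>R real n) = N x / real n"
    using n by (simp add: vector_norm_scale[OF N] divide_inverse mult.commute)
  moreover have "(x /\<^sub>R real n) $ j / N (x /\<^sub>R real n) = x $ j / N x" for j
    unfolding Nn using n by (simp add: field_simps)
  moreover have "1 < N x / real n \<longleftrightarrow> real n < N x" using n by (simp add: field_simps)
  ultimately show ?thesis
    unfolding mem_scaled_image_iff[OF n] face_nbhd_def mem_Collect_eq by (simp only:)
qed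

text \<open>The null conditions cover every part of the bound for the relative frontier, and
  \<open>N \<ge> 1\<close> on the closure keeps it away from the origin. Finite mass allows the
  limit to be stated in the reals.\<close>

lemma regularly_varying_face_nbhd:
  fixes \<mu> :: "(real ^ 'd) measure"
  assumes rv: "regularly_varying M X \<mu>" and N: "vector_norm N" and sets: "sets \<mu> = sets borel"
    and fin: "emeasure \<mu> {x \<in> \<bbbE>. 1 < N x} \<noteq> \<infinity>"
    and h: "\<And>j. continuous_on \<bbbE> (h j)" "\<And>j. h j \<in> borel_measurable borel"
    and sphere: "emeasure \<mu> {x \<in> \<bbbE>. N x = 1} = 0"
    and a: "\<And>j. emeasure \<mu> {x \<in> \<bbbE>. 1 < N x \<and> h j x = a} = 0"
    and b: "\<And>j. emeasure \<mu> {x \<in> \<bbbE>. 1 < N x \<and> h j x = b} = 0"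
  shows "(\<lambda>n. real n * \<P>(\<omega> in M. X \<omega> \<in> (\<lambda>x. real n *\<^sub>R x) ` face_nbhd N h J a b))
    \<longlonglongrightarrow> measure \<mu> (face_nbhd N h J a b)"
proof -
  let ?B = "face_nbhd N h J a b"
  have [measurable]: "N \<in> borel_measurable borel"
    by (rule borel_measurable_continuous_onI[OF continuous_on_vector_norm[OF N]])
  note [measurable] = h(2)
  have B: "?B \<in> sets borel" by (rule face_nbhd_borel) measurable
  have "?B \<subseteq> \<bbbE>" by (auto simp: face_nbhd_def)
  have "closed (N -` {1..})" using continuous_on_vector_norm[OF N] by (intro closed_vimage) auto
  then have "closure ?B \<subseteq> N -` {1..}" by (intro closure_minimal) (auto simp: face_nbhd_def)
  moreover have "N 0 = 0" using N by (simp add: vector_norm_def)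
  ultimately have "0 \<notin> closure ?B" by auto
  let ?Z = "{x \<in> \<bbbE>. N x = 1} \<union> (\<Union>j. {x \<in> \<bbbE>. 1 < N x \<and> h j x = a}) \<union> (\<Union>j. {x \<in> \<bbbE>. 1 < N x \<and> h j x = b})"
  have "?Z \<in> null_sets \<mu>"
  proof (intro null_sets.Un null_sets_UN)
    show "{x \<in> \<bbbE>. N x = 1} \<in> null_sets \<mu>" using sphere by (intro null_setsI) (simp_all add: sets, measurable)
    show "{x \<in> \<bbbE>. 1 < N x \<and> h j x = a} \<in> null_sets \<mu>" for j
      using a by (intro null_setsI) (simp_all add: sets, measurable)
    show "{x \<in> \<bbbE>. 1 < N x \<and> h j x = b} \<in> null_sets \<mu>" for j
      using b by (intro null_setsI) (simp_all add: sets, measurable)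
  qed
  moreover have "top_of_set \<bbbE> frontier_of ?B \<subseteq> ?Z"
    using continuous_on_vector_norm[OF N] by (intro frontier_face_nbhd h(1)) (blast intro: continuous_on_subset)
  ultimately have "emeasure \<mu> (top_of_set \<bbbE> frontier_of ?B) = 0"
    using emeasure_mono[of "top_of_set \<bbbE> frontier_of ?B" ?Z \<mu>] by (auto simp: null_sets_def)
  with rv B \<open>?B \<subseteq> \<bbbE>\<close> \<open>0 \<notin> closure ?B\<close>
  have "(\<lambda>n. ennreal (real n * \<P>(\<omega> in M. X \<omega> \<in> (\<lambda>x. real n *\<^sub>R x) ` ?B))) \<longlonglongrightarrow> emeasure \<mu> ?B"
    unfolding regularly_varying_def by blast
  moreover have "emeasure \<mu> ?B \<noteq> \<infinity>"
  proof -
    have "{x \<in> \<bbbE>. 1 < N x} \<in> sets \<mu>" unfolding sets by measurable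
    moreover have "?B \<subseteq> {x \<in> \<bbbE>. 1 < N x}" by (auto simp: face_nbhd_def)
    ultimately show ?thesis using emeasure_mono fin by (metis infinity_ennreal_def top_unique)
  qed
  then have "emeasure \<mu> ?B = ennreal (measure \<mu> ?B)" by (simp add: emeasure_eq_ennreal_measure)
  ultimately show ?thesis by (simp add: tendsto_ennreal_iff)
qed

text \<open>A distribution function is monotone, hence Borel.\<close>

lemma borel_measurable_frechet_standardization:
  fixes \<xi> :: "'a \<Rightarrow> real ^ 'd"
  assumes M: "prob_space M" and [measurable]: "\<xi> \<in> borel_measurable M"
  shows "frechet_standardization M \<xi> \<in> borel_measurable M"
proof -
  interpret M: prob_space M by fact
  have [measurable]: "(\<lambda>\<omega>. \<xi> \<omega> $ j) \<in> borel_measurable M" for j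
    using borel_measurable_vec_iff assms(2) by blast
  have "cdf (marginal (distr M borel \<xi>) j) \<in> borel_measurable borel" for j
  proof (rule borel_measurable_mono, rule monoI)
    have "marginal (distr M borel \<xi>) j = distr M borel (\<lambda>\<omega>. \<xi> \<omega> $ j)"
      unfolding marginal_def by (simp add: distr_distr o_def)
    then interpret F: real_distribution "marginal (distr M borel \<xi>) j" by simp
    show "cdf (marginal (distr M borel \<xi>) j) x \<le> cdf (marginal (distr M borel \<xi>) j) y" if "x \<le> y" for x y
      using that by (rule F.cdf_nondecreasing)
  qed
  note [measurable] = this
  show ?thesis
    unfolding borel_measurable_vec_iff frechet_standardization_def by simp
qed

text \<open>Thresholds \<open>u\<close> for \<open>J\<close> and \<open>l\<close> for its complement
  give a subset of the cone, the exchanged thresholds a superset. Both are continuity sets, so their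
  scaled probabilities converge and bound the \<open>limsup\<close>.\<close>

lemma cone_region_limsup_bounds:
  fixes \<mu> :: "(real ^ 'd) measure" and J :: "'d set"
  assumes M: "prob_space M" and X: "X \<in> borel_measurable M"
    and rv: "regularly_varying M X \<mu>" and N: "vector_norm N" and sets: "sets \<mu> = sets borel"
    and fin: "emeasure \<mu> {x \<in> \<bbbE>. 1 < N x} \<noteq> \<infinity>"
    and sphere: "emeasure \<mu> {x \<in> \<bbbE>. N x = 1} = 0"
    and l: "\<And>j. emeasure \<mu> {x \<in> \<bbbE>. 1 < N x \<and> x $ j / N x = l} = 0" "l \<le> \<epsilon>"
    and u: "\<And>j. emeasure \<mu> {x \<in> \<bbbE>. 1 < N x \<and> x $ j / N x = u} = 0" "\<epsilon> \<le> u"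
  defines "f \<equiv> limsup (\<lambda>n. ereal (real n * \<P>(\<omega> in M. X \<omega> \<in> cone_region N \<epsilon> n J)))"
  shows "ereal (measure \<mu> (face_nbhd N (\<lambda>j x. x $ j / N x) J u l)) \<le> f"
    and "f \<le> ereal (measure \<mu> (face_nbhd N (\<lambda>j x. x $ j / N x) J l u))"
proof -
  interpret prob_space M by fact
  note [measurable] = X
  let ?h = "\<lambda>j x. x $ j / N x"
  let ?P = "\<lambda>n a b. \<P>(\<omega> in M. X \<omega> \<in> (\<lambda>x. real n *\<^sub>R x) ` face_nbhd N ?h J a b)"
  let ?Q = "\<lambda>n. \<P>(\<omega> in M. X \<omega> \<in> cone_region N \<epsilon> n J)"
  have [measurable]: "N \<in> borel_measurable borel"
    by (rule borel_measurable_continuous_onI[OF continuous_on_vector_norm[OF N]])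
  have c: "continuous_on \<bbbE> (?h j)" for j
    using vector_norm_pos[OF N]
    by (intro continuous_intros continuous_on_subset[OF continuous_on_vector_norm[OF N]])
      (force simp: punctured_orthant_def)+
  have m: "?h j \<in> borel_measurable borel" for j by measurable
  note rv_lim = regularly_varying_face_nbhd[OF rv N sets fin c m sphere]
  have lim: "(\<lambda>n. ereal (real n * ?P n u l)) \<longlonglongrightarrow> ereal (measure \<mu> (face_nbhd N ?h J u l))"
    "(\<lambda>n. ereal (real n * ?P n l u)) \<longlonglongrightarrow> ereal (measure \<mu> (face_nbhd N ?h J l u))"
    using rv_lim[OF u(1) l(1)] rv_lim[OF l(1) u(1)] by simp_all
  \<comment> \<open>The lower bound 0 on the quotients outside \<open>J\<close> holds automatically
    on \<open>\<bbbE>\<close>.\<close>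
  have cone: "cone_region N \<epsilon> n J = {x \<in> \<bbbE>. real n < N x \<and> (\<forall>j\<in>J. \<epsilon> < x $ j / N x) \<and> (\<forall>j\<in>-J. x $ j / N x \<le> \<epsilon>)}" for n
    using N by (auto simp: cone_region_def punctured_orthant_def vector_norm_def)
  have cb: "cone_region N \<epsilon> n J \<in> sets borel" for n unfolding cone by measurable
  have ib: "(\<lambda>x. real n *\<^sub>R x) ` face_nbhd N ?h J a b \<in> sets borel" if "0 < n" for n a b
  proof -
    have "(\<lambda>x. real n *\<^sub>R x) ` face_nbhd N ?h J a b =
      {x \<in> \<bbbE>. real n < N x \<and> (\<forall>j\<in>J. a < x $ j / N x) \<and> (\<forall>j\<in>-J. x $ j / N x \<le> b)}"
      using mem_scaled_face_nbhd_cone_iff[OF N that] by blast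
    also have "\<dots> \<in> sets borel" by measurable
    finally show ?thesis .
  qed
  have ev: "{\<omega> \<in> space M. X \<omega> \<in> B} \<in> sets M" if "B \<in> sets borel" for B
    using measurable_sets[OF X that] by (simp add: vimage_def Int_def conj_commute)
  have "?P n u l \<le> ?Q n" "?Q n \<le> ?P n l u" if n: "0 < n" for n
    using l(2) u(2)
    by (auto intro!: finite_measure_mono ev cb ib[OF n] simp: cone mem_scaled_face_nbhd_cone_iff[OF N n]
        intro: order_trans le_less_trans)
  then have "\<forall>\<^sub>F n in sequentially. ereal (real n * ?P n u l) \<le> ereal (real n * ?Q n)"
    "\<forall>\<^sub>F n in sequentially. ereal (real n * ?Q n) \<le> ereal (real n * ?P n l u)"
    by (auto intro!: eventually_mono[OF eventually_gt_at_top[of 0]] mult_left_mono)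
  from this[THEN Limsup_mono] lim[THEN lim_imp_Limsup[rotated]]
  show "ereal (measure \<mu> (face_nbhd N ?h J u l)) \<le> f" "f \<le> ereal (measure \<mu> (face_nbhd N ?h J l u))"
    by (simp_all add: f_def)
qed

text \<open>Null levels \<open>l \<epsilon>\<close> below and \<open>u \<epsilon>\<close> above
  \<open>\<epsilon>\<close> tend to 0 with \<open>\<epsilon>\<close>, so both bounds have the same
  limit.\<close>

lemma cone_region_limsup_tendsto:
  fixes \<mu> :: "(real ^ 'd) measure" and J :: "'d set"
  assumes M: "prob_space M" and X: "X \<in> borel_measurable M"
    and rv: "regularly_varying M X \<mu>" and N: "vector_norm N" and sets: "sets \<mu> = sets borel"
    and fin: "emeasure \<mu> {x \<in> \<bbbE>. 1 < N x} \<noteq> \<infinity>"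
    and sphere: "emeasure \<mu> {x \<in> \<bbbE>. N x = 1} = 0"
  shows "((\<lambda>\<epsilon>. limsup (\<lambda>n. ereal (real n * \<P>(\<omega> in M. X \<omega> \<in> cone_region N \<epsilon> n J)))) \<longlongrightarrow>
    ereal (measure \<mu> (face_nbhd N (\<lambda>j x. x $ j / N x) J 0 0))) (at_right 0)"
proof -
  let ?h = "\<lambda>j x. x $ j / N x"
  have [measurable]: "N \<in> borel_measurable borel"
    by (rule borel_measurable_continuous_onI[OF continuous_on_vector_norm[OF N]])
  have m: "?h j \<in> borel_measurable borel" for j by measurable
  have A: "{x \<in> \<bbbE>. 1 < N x} \<in> sets \<mu>" unfolding sets by measurable
  have m': "?h j \<in> borel_measurable \<mu>" for j using m sets measurable_cong_sets by blast
  define good where "good c \<longleftrightarrow> (\<forall>j. emeasure \<mu> {x \<in> \<bbbE>. 1 < N x \<and> x $ j / N x = c} = 0)" for c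
  have ex: "\<exists>c. p < c \<and> c < q \<and> good c" if "p < q" for p q
    using exists_null_level[where h = ?h, OF m' A fin that] unfolding good_def by (auto simp: conj_assoc)
  have "\<forall>\<epsilon>. \<exists>c. 0 < \<epsilon> \<longrightarrow> 0 < c \<and> c < \<epsilon> \<and> good c" using ex by meson
  then obtain l where l: "\<And>\<epsilon>. 0 < \<epsilon> \<Longrightarrow> 0 < l \<epsilon> \<and> l \<epsilon> < \<epsilon> \<and> good (l \<epsilon>)" by metis
  \<comment> \<open>The bound \<open>2 * \<epsilon>\<close> forces \<open>u\<close> to tend to
    0.\<close>
  have "\<forall>\<epsilon>. \<exists>c. 0 < \<epsilon> \<longrightarrow> \<epsilon> < c \<and> c < 2 * \<epsilon> \<and> good c" using ex by (metis mult_2 less_add_same_cancel1)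
  then obtain u where u: "\<And>\<epsilon>. 0 < \<epsilon> \<Longrightarrow> \<epsilon> < u \<epsilon> \<and> u \<epsilon> < 2 * \<epsilon> \<and> good (u \<epsilon>)" by metis
  have pos: "\<forall>\<^sub>F \<epsilon> in at_right (0::real). 0 < \<epsilon>" by (simp add: eventually_at_right_less)
  have lim2: "((\<lambda>\<epsilon>. 2 * \<epsilon>) \<longlongrightarrow> (0::real)) (at_right 0)" by (auto intro!: tendsto_eq_intros)
  have l0: "(l \<longlongrightarrow> 0) (at_right 0)"
    by (rule tendsto_sandwich[OF _ _ tendsto_const lim2]; rule eventually_mono[OF pos]) (use l in force)+
  have u0: "(u \<longlongrightarrow> 0) (at_right 0)"
    by (rule tendsto_sandwich[OF _ _ tendsto_const lim2]; rule eventually_mono[OF pos]) (use u in force)+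
  have l00: "0 \<le> l \<epsilon>" and u00: "0 \<le> u \<epsilon>" if "0 < \<epsilon>" for \<epsilon>
    using l[OF that] u[OF that] that by linarith+
  note bounds = cone_region_limsup_bounds[OF M X rv N sets fin sphere]
  have bd: "ereal (measure \<mu> (face_nbhd N ?h J (u \<epsilon>) (l \<epsilon>)))
      \<le> limsup (\<lambda>n. ereal (real n * \<P>(\<omega> in M. X \<omega> \<in> cone_region N \<epsilon> n J)))"
    "limsup (\<lambda>n. ereal (real n * \<P>(\<omega> in M. X \<omega> \<in> cone_region N \<epsilon> n J)))
      \<le> ereal (measure \<mu> (face_nbhd N ?h J (l \<epsilon>) (u \<epsilon>)))" if "0 < \<epsilon>" for \<epsilon>
    using bounds[of "l \<epsilon>" \<epsilon> "u \<epsilon>" J] l[OF that] u[OF that] by (auto simp: good_def)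
  show ?thesis
  proof (rule tendsto_sandwich)
    show "((\<lambda>\<epsilon>. ereal (measure \<mu> (face_nbhd N ?h J (u \<epsilon>) (l \<epsilon>)))) \<longlongrightarrow> ereal (measure \<mu> (face_nbhd N ?h J 0 0))) (at_right 0)"
      using face_nbhd_tendsto[where h = ?h, OF sets fin _ m u0 u00 l0 l00] by simp
    show "((\<lambda>\<epsilon>. ereal (measure \<mu> (face_nbhd N ?h J (l \<epsilon>) (u \<epsilon>)))) \<longlongrightarrow> ereal (measure \<mu> (face_nbhd N ?h J 0 0))) (at_right 0)"
      using face_nbhd_tendsto[where h = ?h, OF sets fin _ m l0 l00 u0 u00] by simp
  qed (rule eventually_mono[OF pos], rule bd, assumption)+
qed

section \<open>The generators\<close>

lemma borel_measurable_eexp_vec: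
  fixes U :: "'b \<Rightarrow> 'd :: finite \<Rightarrow> ereal"
  assumes "U \<in> M \<rightarrow>\<^sub>M ext_vec"
  shows "(\<lambda>\<omega>. \<chi> j. eexp (U \<omega> j)) \<in> borel_measurable M"
proof -
  have [measurable]: "(\<lambda>\<omega>. U \<omega> j) \<in> borel_measurable M" for j
    using assms by (rule measurable_compose) (rule measurable_component_singleton, simp)
  show ?thesis unfolding borel_measurable_vec_iff by simp
qed

lemma U_generator_ray_measure:
  fixes G \<mu> :: "(real ^ 'd) measure"
  assumes G: "sets G = sets borel" "unit_frechet_margins G" and \<mu>: "exponent_measure G \<mu>"
    and U: "U_generator G M U" and A: "A \<in> sets borel" "A \<subseteq> \<bbbE>"
  shows "emeasure \<mu> A = emeasure (ray_measure M (\<lambda>\<omega>. \<chi> j. eexp (U \<omega> j))) A"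
proof (rule exponent_measure_eq_ray_measure[OF G \<mu> _ _ _ _ A])
  show "(\<lambda>\<omega>. \<chi> j. eexp (U \<omega> j)) \<in> borel_measurable M"
    using U unfolding U_generator_def by (blast intro: borel_measurable_eexp_vec)
  \<comment> \<open>A non-integrable function would have integral 0 instead of 1.\<close>
  show "integrable M (\<lambda>\<omega>. (\<chi> j. eexp (U \<omega> j)) $ j)" for j
    using U not_integrable_integral_eq[of M "\<lambda>\<omega>. eexp (U \<omega> j)"] unfolding U_generator_def by fastforce
qed (use U in \<open>simp_all add: eexp_nonneg U_generator_def\<close>)

text \<open>Dividing \<open>eexp (S \<omega> j)\<close> by its mean \<open>\<kappa>\<close> absorbs
  the denominator in the formula for \<open>stdf\<close>. The mean is positive because the component
  exceeds \<open>- \<infinity>\<close> with positive probability, and finite because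
  \<open>S\<close> is nonpositive.\<close>

lemma spectral_vector_ray_measure:
  fixes G \<mu> :: "(real ^ 'd) measure"
  assumes G: "sets G = sets borel" "unit_frechet_margins G" and \<mu>: "exponent_measure G \<mu>"
    and S: "spectral_vector G M S"
  obtains \<kappa> where "0 < \<kappa>" "(\<lambda>\<omega>. \<chi> j. eexp (S \<omega> j) / \<kappa>) \<in> borel_measurable M"
    "\<And>A. A \<in> sets borel \<Longrightarrow> A \<subseteq> \<bbbE> \<Longrightarrow> emeasure \<mu> A = emeasure (ray_measure M (\<lambda>\<omega>. \<chi> j. eexp (S \<omega> j) / \<kappa>)) A"
proof -
  interpret prob_space M using S by (simp add: spectral_vector_def)
  have [measurable]: "(\<lambda>\<omega>. S \<omega> j) \<in> borel_measurable M" for j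
    using S unfolding spectral_vector_def by (auto intro: measurable_compose[OF _ measurable_component_singleton])
  have int: "integrable M (\<lambda>\<omega>. eexp (S \<omega> j))" for j
  proof (rule integrable_const_bound[where B = 1])
    have "eexp (S \<omega> j) \<le> 1" if "\<omega> \<in> space M" for \<omega>
    proof -
      have "S \<omega> j \<le> 0" using S that by (simp add: spectral_vector_def)
      then show ?thesis by (cases "S \<omega> j") (auto simp: eexp_def)
    qed
    then show "AE \<omega> in M. norm (eexp (S \<omega> j)) \<le> 1"
      by (intro AE_I2) (simp add: eexp_nonneg)
  qed measurable
  define i :: 'd where "i = undefined"
  define \<kappa> where "\<kappa> = (\<integral>\<omega>. eexp (S \<omega> i) \<partial>M)"
  have "\<kappa> \<noteq> 0"
  proof
    assume "\<kappa> = 0"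
    then have "AE \<omega> in M. eexp (S \<omega> i) = 0"
      unfolding \<kappa>_def using int eexp_nonneg by (subst (asm) integral_nonneg_eq_0_iff_AE) auto
    then have "AE \<omega> in M. \<not> - \<infinity> < S \<omega> i"
      by eventually_elim (metis eexp_pos_iff less_irrefl)
    then have "\<P>(\<omega> in M. - \<infinity> < S \<omega> i) = 0" by (rule prob_eq_0_AE)
    moreover have "0 < \<P>(\<omega> in M. - \<infinity> < S \<omega> i)" using S unfolding spectral_vector_def by blast
    ultimately show False by simp
  qed
  moreover have "0 \<le> \<kappa>" unfolding \<kappa>_def by (rule integral_nonneg_AE) (simp add: eexp_nonneg)
  ultimately have \<kappa>: "0 < \<kappa>" by simp
  have meas: "(\<lambda>\<omega>. \<chi> j. eexp (S \<omega> j) / \<kappa>) \<in> borel_measurable M"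
    unfolding borel_measurable_vec_iff by simp
  have "emeasure \<mu> A = emeasure (ray_measure M (\<lambda>\<omega>. \<chi> j. eexp (S \<omega> j) / \<kappa>)) A"
    if A: "A \<in> sets borel" "A \<subseteq> \<bbbE>" for A
  proof (rule exponent_measure_eq_ray_measure[OF G \<mu> meas _ _ _ A])
    fix y :: "real ^ 'd" assume y: "\<And>j. 0 \<le> y $ j"
    have Max_div: "Max (range (\<lambda>j. y $ j * eexp (S \<omega> j))) / \<kappa> = Max (range (\<lambda>j. y $ j * (\<chi> j. eexp (S \<omega> j) / \<kappa>) $ j))" for \<omega>
    proof -
      have "mono (\<lambda>t. t / \<kappa>)" using \<kappa> by (simp add: mono_def divide_right_mono)
      from mono_Max_commute[OF this, of "range (\<lambda>j. y $ j * eexp (S \<omega> j))"]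
      show ?thesis by (simp add: image_image)
    qed
    have "stdf G y = (\<integral>\<omega>. Max (range (\<lambda>j. y $ j * eexp (S \<omega> j))) \<partial>M) / \<kappa>"
      using S y unfolding spectral_vector_def \<kappa>_def by blast
    also have "\<dots> = (\<integral>\<omega>. Max (range (\<lambda>j. y $ j * eexp (S \<omega> j))) / \<kappa> \<partial>M)" by simp
    also have "\<dots> = (\<integral>\<omega>. Max (range (\<lambda>j. y $ j * (\<chi> j. eexp (S \<omega> j) / \<kappa>) $ j)) \<partial>M)"
      by (simp only: Max_div)
    finally show "stdf G y = (\<integral>\<omega>. Max (range (\<lambda>j. y $ j * (\<chi> j. eexp (S \<omega> j) / \<kappa>) $ j)) \<partial>M)" .
  qed (use int \<kappa> in \<open>simp_all add: eexp_nonneg\<close>)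
  with \<kappa> meas that show ?thesis by blast
qed

text \<open>Subtracting a finite maximum does not change which components are infinite, and the
  difference has the law of \<open>S\<close>.\<close>

lemma T_generator_face_prob:
  fixes S :: "'s \<Rightarrow> 'd :: finite \<Rightarrow> ereal"
  assumes S: "S \<in> M\<^sub>S \<rightarrow>\<^sub>M ext_vec" and T: "T_generator M\<^sub>S S M\<^sub>T T"
  shows "\<P>(\<omega> in M\<^sub>T. \<forall>j. - \<infinity> < T \<omega> j \<longleftrightarrow> j \<in> J) = \<P>(\<omega> in M\<^sub>S. \<forall>j. - \<infinity> < S \<omega> j \<longleftrightarrow> j \<in> J)"
proof -
  interpret prob_space M\<^sub>T using T by (simp add: T_generator_def)
  define m where "m \<omega> = Max (range (T \<omega>))" for \<omega>
  have [measurable]: "(\<lambda>\<omega>. T \<omega> j) \<in> borel_measurable M\<^sub>T" for j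
    using T unfolding T_generator_def by (auto intro: measurable_compose[OF _ measurable_component_singleton])
  have [measurable]: "m \<in> borel_measurable M\<^sub>T"
    unfolding m_def using borel_measurable_Max[of "UNIV :: 'd set" "\<lambda>j \<omega>. T \<omega> j" M\<^sub>T] by simp
  have R: "(\<lambda>\<omega> j. T \<omega> j - m \<omega>) \<in> M\<^sub>T \<rightarrow>\<^sub>M ext_vec"
    by (rule measurable_PiM_single') simp_all
  define F where "F = {x \<in> space (ext_vec :: ('d \<Rightarrow> ereal) measure). \<forall>j. - \<infinity> < x j \<longleftrightarrow> j \<in> J}"
  have F: "F \<in> sets ext_vec" unfolding F_def by measurable
  have "\<P>(\<omega> in M\<^sub>S. \<forall>j. - \<infinity> < S \<omega> j \<longleftrightarrow> j \<in> J) = measure (distr M\<^sub>S ext_vec S) F"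
    using S F by (subst measure_distr) (auto simp: F_def space_PiM intro!: arg_cong[where f = "measure M\<^sub>S"])
  also have "distr M\<^sub>S ext_vec S = distr M\<^sub>T ext_vec (\<lambda>\<omega> j. T \<omega> j - m \<omega>)"
    using T unfolding T_generator_def m_def by blast
  also have "measure \<dots> F = \<P>(\<omega> in M\<^sub>T. \<forall>j. - \<infinity> < T \<omega> j - m \<omega> \<longleftrightarrow> j \<in> J)"
    using R F by (subst measure_distr) (auto simp: F_def space_PiM intro!: arg_cong[where f = "measure M\<^sub>T"])
  also have "\<dots> = \<P>(\<omega> in M\<^sub>T. \<forall>j. - \<infinity> < T \<omega> j \<longleftrightarrow> j \<in> J)"
  \<comment> \<open>The events are compared only almost everywhere, since the subtraction is
    harmless only where \<open>m \<omega>\<close> is finite.\<close>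
  proof (rule prob_eq_AE)
    have "\<P>(\<omega> in M\<^sub>T. - \<infinity> < m \<omega>) = 1" using T unfolding T_generator_def m_def by blast
    then have "AE \<omega> in M\<^sub>T. - \<infinity> < m \<omega>" by (subst (asm) prob_Collect_eq_1) auto
    then show "AE \<omega> in M\<^sub>T. (\<forall>j. - \<infinity> < T \<omega> j - m \<omega> \<longleftrightarrow> j \<in> J) \<longleftrightarrow> (\<forall>j. - \<infinity> < T \<omega> j \<longleftrightarrow> j \<in> J)"
    proof (rule AE_mp[OF _ AE_I2], intro impI)
      fix \<omega> assume \<omega>: "\<omega> \<in> space M\<^sub>T" "- \<infinity> < m \<omega>"
      have "m \<omega> \<in> range (T \<omega>)" unfolding m_def by (rule Max_in) auto
      then obtain i where "m \<omega> = T \<omega> i" by blast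
      moreover have "T \<omega> i < \<infinity>" using T \<omega>(1) unfolding T_generator_def by blast
      ultimately have "m \<omega> < \<infinity>" by simp
      with \<omega>(2) have "- \<infinity> < T \<omega> j - m \<omega> \<longleftrightarrow> - \<infinity> < T \<omega> j" for j
        by (cases "m \<omega>"; cases "T \<omega> j") auto
      then show "(\<forall>j. - \<infinity> < T \<omega> j - m \<omega> \<longleftrightarrow> j \<in> J) \<longleftrightarrow> (\<forall>j. - \<infinity> < T \<omega> j \<longleftrightarrow> j \<in> J)" by simp
    qed
  qed measurable
  finally show ?thesis by simp
qed

text \<open>The law of \<open>Y\<close> is evaluated on the face, where membership of the
  exponential records exactly the finite components of \<open>Y\<close>.\<close>

lemma mgp_vector_face_pos_iff:
  fixes \<mu> :: "(real ^ 'd) measure"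
  assumes Y: "mgp_vector \<mu> M Y" and J: "J \<noteq> {}"
    and fin: "emeasure \<mu> (\<bbbE> - {..\<chi> j. 1}) \<noteq> \<infinity>" and sets: "sets \<mu> = sets borel"
  shows "0 < \<P>(\<omega> in M. \<forall>j. - \<infinity> < Y \<omega> j \<longleftrightarrow> j \<in> J) \<longleftrightarrow> 0 < emeasure \<mu> (face J - {..\<chi> j. 1})"
proof -
  let ?A = "{x :: real ^ 'd. (\<forall>j. 0 \<le> x $ j) \<and> \<not> (\<forall>j. x $ j \<le> 1)}"
  have A: "?A = \<bbbE> - {..\<chi> j. 1}"
    by (auto simp: punctured_orthant_def less_eq_vec_def)
  have f: "face J \<inter> (\<bbbE> - {..\<chi> j. 1}) = face J - {..\<chi> j. 1}" using face_subset by blast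
  have Y_face: "\<P>(\<omega> in M. (\<chi> j. eexp (Y \<omega> j)) \<in> face J) = measure \<mu> (face J \<inter> ?A) / measure \<mu> ?A"
  proof -
    have "face J \<subseteq> {x. \<forall>j. 0 \<le> x $ j}" by (auto simp: face_def punctured_orthant_def)
    then show ?thesis using Y face_borel[of J] unfolding mgp_vector_def Let_def by blast
  qed
  have face_Y: "(\<chi> j. eexp (Y \<omega> j)) \<in> face J \<longleftrightarrow> (\<forall>j. - \<infinity> < Y \<omega> j \<longleftrightarrow> j \<in> J)" for \<omega>
    using face_iff[OF J, of "\<chi> j. eexp (Y \<omega> j)"] by (simp add: eexp_nonneg eexp_pos_iff)
  have P: "\<P>(\<omega> in M. \<forall>j. - \<infinity> < Y \<omega> j \<longleftrightarrow> j \<in> J) = measure \<mu> (face J - {..\<chi> j. 1}) / measure \<mu> (\<bbbE> - {..\<chi> j. 1})"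
    using Y_face unfolding A f face_Y .
  \<comment> \<open>By this comparison the denominator is positive whenever the numerator
    is.\<close>
  have "\<bbbE> - {..\<chi> j. 1} \<in> sets \<mu>" unfolding sets by measurable
  then have le: "emeasure \<mu> (face J - {..\<chi> j. 1}) \<le> emeasure \<mu> (\<bbbE> - {..\<chi> j. 1})"
    using face_subset by (intro emeasure_mono) auto
  with fin have "emeasure \<mu> (face J - {..\<chi> j. 1}) \<noteq> \<infinity>" by (auto simp: top_unique)
  then show ?thesis
    using le fin unfolding P by (auto simp: emeasure_eq_ennreal_measure zero_less_divide_iff)
qed

text \<open>At most one parameter \<open>s\<close> of a ray solves the first equation and at most
  two solve the second. With \<open>c = 0\<close> and \<open>g = 0\<close> every \<open>s\<close>
  would.\<close>

lemma countable_scale_eq: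
  fixes g c :: real
  assumes "c \<noteq> 0"
  shows "countable {s. inverse s * g = c}" "countable {s. \<bar>inverse s\<bar> * g = c}"
proof -
  have "s = g / c \<or> s = - (g / c)" if "\<bar>inverse s\<bar> * g = c" for s
    using that assms by (auto simp: field_simps abs_if split: if_splits)
  then have "{s. \<bar>inverse s\<bar> * g = c} \<subseteq> {g / c, - (g / c)}" by auto
  then show "countable {s. \<bar>inverse s\<bar> * g = c}" by (rule countable_subset) simp
  have "s = g / c" if "inverse s * g = c" for s
    using that assms by (auto simp: field_simps)
  then have "{s. inverse s * g = c} \<subseteq> {g / c}" by auto
  then show "countable {s. inverse s * g = c}" by (rule countable_subset) simp
qed

theorem theorem3p6:
  fixes M :: "'a measure" and \<xi> X :: "'a \<Rightarrow> real ^ 'd"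
    and G\<^sub>0 G \<mu> :: "(real ^ 'd) measure"
    and N :: "real ^ 'd \<Rightarrow> real"
    and M\<^sub>Y :: "'y measure" and Y :: "'y \<Rightarrow> 'd \<Rightarrow> ereal"
    and M\<^sub>S :: "'s measure" and S :: "'s \<Rightarrow> 'd \<Rightarrow> ereal"
    and M\<^sub>T :: "'t measure" and T :: "'t \<Rightarrow> 'd \<Rightarrow> ereal"
    and M\<^sub>U :: "'u measure" and U :: "'u \<Rightarrow> 'd \<Rightarrow> ereal"
    and J :: "'d set"
  assumes "prob_space M" and "\<xi> \<in> M \<rightarrow>\<^sub>M borel"
    and "mev_distribution G\<^sub>0" and "in_domain_of_attraction (distr M borel \<xi>) G\<^sub>0"
    and "X = frechet_standardization M \<xi>"
    and "standardized_mev_limit M X G"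
    and "exponent_measure G \<mu>"
    and "regularly_varying M X \<mu>"
    and "vector_norm N"
    and "mgp_vector \<mu> M\<^sub>Y Y"
    and "spectral_vector G M\<^sub>S S"
    and "T_generator M\<^sub>S S M\<^sub>T T"
    and "U_generator G M\<^sub>U U"
    and "J \<noteq> {}"
  shows
    \<comment> \<open>the limits in the third and fourth statement exist\<close>
    "(\<forall>\<epsilon>>0. convergent (\<lambda>n. real n * \<P>(\<omega> in M. X \<omega> \<in> rectangle_region N \<epsilon> n J))) \<and>
     (\<exists>L. ((\<lambda>\<epsilon>. lim (\<lambda>n. real n * \<P>(\<omega> in M. X \<omega> \<in> rectangle_region N \<epsilon> n J))) \<longlongrightarrow> L) (at_right 0)) \<and>
     (\<exists>L :: real. ((\<lambda>\<epsilon>. limsup (\<lambda>n. ereal (real n * \<P>(\<omega> in M. X \<omega> \<in> cone_region N \<epsilon> n J)))) \<longlongrightarrow> ereal L) (at_right 0)) \<and>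
     all_equivalent
      [extreme_direction \<mu> J,
       0 < angular_measure N \<mu> (sphere_face N J),
       0 < Lim (at_right 0) (\<lambda>\<epsilon>. lim (\<lambda>n. real n * \<P>(\<omega> in M. X \<omega> \<in> rectangle_region N \<epsilon> n J))),
       0 < Lim (at_right 0) (\<lambda>\<epsilon>. limsup (\<lambda>n. ereal (real n * \<P>(\<omega> in M. X \<omega> \<in> cone_region N \<epsilon> n J)))),
       0 < \<P>(\<omega> in M\<^sub>Y. \<forall>j. -\<infinity> < Y \<omega> j \<longleftrightarrow> j \<in> J),
       0 < \<P>(\<omega> in M\<^sub>U. \<forall>j. -\<infinity> < U \<omega> j \<longleftrightarrow> j \<in> J),
       0 < \<P>(\<omega> in M\<^sub>T. \<forall>j. -\<infinity> < T \<omega> j \<longleftrightarrow> j \<in> J),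
       0 < \<P>(\<omega> in M\<^sub>S. \<forall>j. -\<infinity> < S \<omega> j \<longleftrightarrow> j \<in> J)]"
proof -
  note M = assms(1) and \<mu> = assms(7) and rv = assms(8) and N = assms(9) and Y = assms(10)
    and S = assms(11) and T = assms(12) and U = assms(13) and J = assms(14)
  have G: "sets G = sets borel" "unit_frechet_margins G"
    using assms(6) by (simp_all add: standardized_mev_limit_def mev_distribution_def)
  have sets: "sets \<mu> = sets borel" using \<mu> by (simp add: exponent_measure_def)
  have X: "X \<in> borel_measurable M"
    unfolding assms(5) by (rule borel_measurable_frechet_standardization[OF M assms(2)])
  have [measurable]: "N \<in> borel_measurable borel"
    by (rule borel_measurable_continuous_onI[OF continuous_on_vector_norm[OF N]])
  have one: "emeasure \<mu> (\<bbbE> - {..\<chi> j. 1}) \<noteq> \<infinity>"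
    by (rule exponent_measure_box_complement_finite[OF G \<mu>]) simp
  have fin: "emeasure \<mu> {x \<in> \<bbbE>. 1 < N x} \<noteq> \<infinity>"
  proof -
    obtain \<delta> where \<delta>: "0 < \<delta>" "{x \<in> \<bbbE>. 1 < N x} \<subseteq> \<bbbE> - {..\<chi> j. \<delta>}"
      by (rule vector_norm_gt_1_bounded_away[OF N])
    have "\<bbbE> - {..\<chi> j. \<delta>} \<in> sets \<mu>" unfolding sets by measurable
    from emeasure_mono[OF \<delta>(2) this] show ?thesis
      using exponent_measure_box_complement_finite[OF G \<mu>, of "\<chi> j. \<delta>"] \<delta>(1) by (auto simp: top_unique)
  qed

  \<comment> \<open>Representation of the exponent measure and null surfaces\<close>
  define V where "V = (\<lambda>\<omega>. \<chi> j. eexp (U \<omega> j))"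
  have V: "V \<in> borel_measurable M\<^sub>U"
    using U unfolding V_def U_generator_def by (blast intro: borel_measurable_eexp_vec)
  have V0: "\<And>\<omega> j. 0 \<le> V \<omega> $ j" by (simp add: V_def eexp_nonneg)
  have \<mu>V: "emeasure \<mu> A = emeasure (ray_measure M\<^sub>U V) A" if "A \<in> sets borel" "A \<subseteq> \<bbbE>" for A
    using U_generator_ray_measure[OF G \<mu> U that] by (simp add: V_def)

  have sphere: "emeasure \<mu> {x \<in> \<bbbE>. N x = 1} = 0"
  proof -
    have "countable {s. v /\<^sub>R s \<in> {x \<in> \<bbbE>. N x = 1}}" for v
      by (rule countable_subset[OF _ countable_scale_eq(2)[of 1 "N v"]]) (auto simp: vector_norm_scale[OF N])
    then show ?thesis by (subst \<mu>V) (auto intro!: ray_measure_null[OF V])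
  qed
  \<comment> \<open>The level 0 is excluded because the faces inside \<open>x $ j = 0\<close> may
    carry mass.\<close>
  have hyperplane: "emeasure \<mu> {x \<in> \<bbbE>. 1 < N x \<and> x $ j = \<epsilon>} = 0" if "0 < \<epsilon>" for \<epsilon> j
  proof -
    have "countable {s. v /\<^sub>R s \<in> {x \<in> \<bbbE>. 1 < N x \<and> x $ j = \<epsilon>}}" for v
      using that by (intro countable_subset[OF _ countable_scale_eq(1)[of \<epsilon> "v $ j"]]) auto
    then show ?thesis by (subst \<mu>V) (auto intro!: ray_measure_null[OF V])
  qed

  \<comment> \<open>The two iterated limits\<close>
  let ?L = "measure \<mu> {x \<in> face J. 1 < N x}"
  have nbhd0: "face_nbhd N (\<lambda>j x. x $ j) J 0 0 = {x \<in> face J. 1 < N x}"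
    "face_nbhd N (\<lambda>j x. x $ j / N x) J 0 0 = {x \<in> face J. 1 < N x}"
    unfolding face_nbhd_def face_def
    by (auto simp: zero_less_divide_iff divide_le_0_iff not_less[symmetric])

  have rect: "(\<lambda>n. real n * \<P>(\<omega> in M. X \<omega> \<in> rectangle_region N \<epsilon> n J))
      \<longlonglongrightarrow> measure \<mu> (face_nbhd N (\<lambda>j x. x $ j) J \<epsilon> \<epsilon>)" if "0 < \<epsilon>" for \<epsilon>
  proof -
    have "(\<lambda>n. real n * \<P>(\<omega> in M. X \<omega> \<in> (\<lambda>x. real n *\<^sub>R x) ` face_nbhd N (\<lambda>j x. x $ j) J \<epsilon> \<epsilon>))
      \<longlonglongrightarrow> measure \<mu> (face_nbhd N (\<lambda>j x. x $ j) J \<epsilon> \<epsilon>)"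
      using hyperplane[OF that]
      by (intro regularly_varying_face_nbhd[OF rv N sets fin _ _ sphere])
        (auto intro: continuous_intros borel_measurable_vec_nth)
    then show ?thesis
    proof (rule Lim_transform_eventually)
      \<comment> \<open>Only \<open>n > 0\<close> counts, as scaling by 0 collapses the set.\<close>
      show "\<forall>\<^sub>F n in sequentially.
        real n * \<P>(\<omega> in M. X \<omega> \<in> (\<lambda>x. real n *\<^sub>R x) ` face_nbhd N (\<lambda>j x. x $ j) J \<epsilon> \<epsilon>) =
        real n * \<P>(\<omega> in M. X \<omega> \<in> rectangle_region N \<epsilon> n J)"
        using eventually_gt_at_top[of 0] by eventually_elim (simp only: scaled_face_nbhd_rectangle[OF N])
    qed
  qed
  have "((\<lambda>\<epsilon>. measure \<mu> (face_nbhd N (\<lambda>j x. x $ j) J \<epsilon> \<epsilon>)) \<longlongrightarrow> ?L) (at_right 0)"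
    using face_nbhd_tendsto[of \<mu> N "\<lambda>j x. x $ j" "\<lambda>\<epsilon>. \<epsilon>" "\<lambda>\<epsilon>. \<epsilon>" J] sets fin by (simp add: nbhd0)
  then have rect_lim: "((\<lambda>\<epsilon>. lim (\<lambda>n. real n * \<P>(\<omega> in M. X \<omega> \<in> rectangle_region N \<epsilon> n J))) \<longlongrightarrow> ?L) (at_right 0)"
  proof (rule Lim_transform_eventually)
    show "\<forall>\<^sub>F \<epsilon> in at_right 0. measure \<mu> (face_nbhd N (\<lambda>j x. x $ j) J \<epsilon> \<epsilon>) =
        lim (\<lambda>n. real n * \<P>(\<omega> in M. X \<omega> \<in> rectangle_region N \<epsilon> n J))"
      by (rule eventually_mono[OF eventually_at_right_less]) (simp add: limI[OF rect])
  qed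
  have cone_lim: "((\<lambda>\<epsilon>. limsup (\<lambda>n. ereal (real n * \<P>(\<omega> in M. X \<omega> \<in> cone_region N \<epsilon> n J)))) \<longlongrightarrow> ereal ?L) (at_right 0)"
    using cone_region_limsup_tendsto[OF M X rv N sets fin sphere, of J] by (simp only: nbhd0)

  \<comment> \<open>Mass of the face and the generators\<close>
  have "finite_measure M\<^sub>U" "finite_measure M\<^sub>S"
    using U S by (auto simp: U_generator_def spectral_vector_def prob_space_def)
  have pos: "0 < emeasure \<mu> A \<longleftrightarrow> 0 < \<P>(\<omega> in M\<^sub>U. \<forall>j. - \<infinity> < U \<omega> j \<longleftrightarrow> j \<in> J)"
    if A: "A \<in> sets borel" "A \<subseteq> face J"
      and ray: "\<And>v. v \<in> face J \<Longrightarrow> \<exists>r>0. \<forall>s. 0 < s \<and> s < r \<longrightarrow> v /\<^sub>R s \<in> A" for A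
  proof -
    have "emeasure \<mu> A = emeasure (ray_measure M\<^sub>U V) A" using A face_subset by (intro \<mu>V) blast+
    then show ?thesis
      using ray_measure_face_pos_iff[OF \<open>finite_measure M\<^sub>U\<close> V V0 J A ray] by (simp add: V_def eexp_pos_iff)
  qed
  have face: "0 < emeasure \<mu> (face J) \<longleftrightarrow> 0 < \<P>(\<omega> in M\<^sub>U. \<forall>j. - \<infinity> < U \<omega> j \<longleftrightarrow> j \<in> J)"
    by (rule pos) (auto simp: face_scale_iff intro: zero_less_one)
  have outer: "0 < emeasure \<mu> {x \<in> face J. 1 < N x} \<longleftrightarrow> 0 < \<P>(\<omega> in M\<^sub>U. \<forall>j. - \<infinity> < U \<omega> j \<longleftrightarrow> j \<in> J)"
  proof (rule pos)
    show "{x \<in> face J. 1 < N x} \<in> sets borel" by measurable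
    fix v assume v: "v \<in> face J"
    then have "0 < N v" by (intro vector_norm_pos[OF N]) (auto simp: face_def punctured_orthant_def)
    moreover have "1 < N (v /\<^sub>R s)" if "0 < s" "s < N v" for s
      using that by (simp add: vector_norm_scale[OF N] field_simps)
    \<comment> \<open>The norm of \<open>v /\<^sub>R s\<close> is \<open>N v / s\<close>, which
      exceeds 1 as long as \<open>s < N v\<close>.\<close>
    ultimately show "\<exists>r>0. \<forall>s. 0 < s \<and> s < r \<longrightarrow> v /\<^sub>R s \<in> {x \<in> face J. 1 < N x}"
      using v by (intro exI[of _ "N v"]) (simp add: face_scale_iff)
  qed auto
  have box: "0 < emeasure \<mu> (face J - {..\<chi> j. 1}) \<longleftrightarrow> 0 < \<P>(\<omega> in M\<^sub>U. \<forall>j. - \<infinity> < U \<omega> j \<longleftrightarrow> j \<in> J)"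
  proof (rule pos)
    show "face J - {..\<chi> j. 1} \<in> sets borel" by measurable
    fix v assume v: "v \<in> face J"
    obtain i where "i \<in> J" using J by blast
    then have "0 < v $ i" using v by (simp add: face_def)
    moreover have "\<not> v /\<^sub>R s \<le> (\<chi> j. 1)" if "0 < s" "s < v $ i" for s
    proof -
      have "1 < (v /\<^sub>R s) $ i" using that by (simp add: field_simps)
      then show ?thesis by (auto simp: less_eq_vec_def not_le intro!: exI[of _ i])
    qed
    \<comment> \<open>One coordinate above 1 suffices to leave the box, so \<open>r\<close> is a
      positive coordinate of \<open>v\<close>.\<close>
    ultimately show "\<exists>r>0. \<forall>s. 0 < s \<and> s < r \<longrightarrow> v /\<^sub>R s \<in> face J - {..\<chi> j. 1}"
      using v by (intro exI[of _ "v $ i"]) (simp add: face_scale_iff)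
  qed auto

  \<comment> \<open>A point and its radial projection onto the sphere lie in the same face.\<close>
  have angular: "angular_measure N \<mu> (sphere_face N J) = emeasure \<mu> {x \<in> face J. 1 < N x}"
  proof -
    have "{x \<in> \<bbbE>. 1 < N x \<and> x /\<^sub>R N x \<in> sphere_face N J} = {x \<in> face J. 1 < N x}"
    proof (intro set_eqI iffI)
      fix x assume x: "x \<in> {x \<in> \<bbbE>. 1 < N x \<and> x /\<^sub>R N x \<in> sphere_face N J}"
      then have "x /\<^sub>R N x \<in> face J" by (auto simp: sphere_face_def unit_sphere_def face_def)
      then show "x \<in> {x \<in> face J. 1 < N x}" using x face_scale_iff[of "N x" x J] by auto
    next
      fix x assume x: "x \<in> {x \<in> face J. 1 < N x}"
      then have "x /\<^sub>R N x \<in> face J" using face_scale_iff[of "N x" x J] by auto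
      moreover have "N (x /\<^sub>R N x) = 1" using x by (simp add: vector_norm_scale[OF N])
      ultimately show "x \<in> {x \<in> \<bbbE>. 1 < N x \<and> x /\<^sub>R N x \<in> sphere_face N J}"
        using x by (auto simp: sphere_face_def unit_sphere_def face_def)
    qed
    then show ?thesis by (simp add: angular_measure_def)
  qed
  \<comment> \<open>An infinite mass would be turned into 0 by \<open>measure\<close>, so finiteness
    is checked first.\<close>
  have L: "0 < ?L \<longleftrightarrow> 0 < emeasure \<mu> {x \<in> face J. 1 < N x}"
  proof -
    have "{x \<in> \<bbbE>. 1 < N x} \<in> sets \<mu>" unfolding sets by measurable
    then have "emeasure \<mu> {x \<in> face J. 1 < N x} \<le> emeasure \<mu> {x \<in> \<bbbE>. 1 < N x}"
      using face_subset by (intro emeasure_mono) auto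
    then have "emeasure \<mu> {x \<in> face J. 1 < N x} \<noteq> \<infinity>" using fin by (auto simp: top_unique)
    then show ?thesis by (simp add: emeasure_eq_ennreal_measure)
  qed
  have spectral: "0 < \<P>(\<omega> in M\<^sub>S. \<forall>j. - \<infinity> < S \<omega> j \<longleftrightarrow> j \<in> J) \<longleftrightarrow> 0 < emeasure \<mu> (face J)"
  proof -
    obtain \<kappa> where \<kappa>: "0 < \<kappa>" and W: "(\<lambda>\<omega>. \<chi> j. eexp (S \<omega> j) / \<kappa>) \<in> borel_measurable M\<^sub>S"
      and \<mu>W: "\<And>A. A \<in> sets borel \<Longrightarrow> A \<subseteq> \<bbbE> \<Longrightarrow> emeasure \<mu> A = emeasure (ray_measure M\<^sub>S (\<lambda>\<omega>. \<chi> j. eexp (S \<omega> j) / \<kappa>)) A"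
      by (rule spectral_vector_ray_measure[OF G \<mu> S]) blast
    have "0 < emeasure (ray_measure M\<^sub>S (\<lambda>\<omega>. \<chi> j. eexp (S \<omega> j) / \<kappa>)) (face J) \<longleftrightarrow>
      0 < \<P>(\<omega> in M\<^sub>S. \<forall>j. 0 < (\<chi> j. eexp (S \<omega> j) / \<kappa>) $ j \<longleftrightarrow> j \<in> J)"
      using \<kappa> by (intro ray_measure_face_pos_iff[OF \<open>finite_measure M\<^sub>S\<close> W _ J])
        (auto simp: face_scale_iff eexp_nonneg intro: zero_less_one)
    then show ?thesis
      using \<kappa> \<mu>W[OF face_borel face_subset] by (simp add: zero_less_divide_iff eexp_pos_iff)
  qed
  have T_S: "\<P>(\<omega> in M\<^sub>T. \<forall>j. - \<infinity> < T \<omega> j \<longleftrightarrow> j \<in> J) = \<P>(\<omega> in M\<^sub>S. \<forall>j. - \<infinity> < S \<omega> j \<longleftrightarrow> j \<in> J)"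
    using S by (intro T_generator_face_prob[OF _ T]) (simp add: spectral_vector_def)
  have Lims: "Lim (at_right 0) (\<lambda>\<epsilon>. lim (\<lambda>n. real n * \<P>(\<omega> in M. X \<omega> \<in> rectangle_region N \<epsilon> n J))) = ?L"
    "Lim (at_right 0) (\<lambda>\<epsilon>. limsup (\<lambda>n. ereal (real n * \<P>(\<omega> in M. X \<omega> \<in> cone_region N \<epsilon> n J)))) = ereal ?L"
    by (rule tendsto_Lim[OF _ rect_lim], simp, rule tendsto_Lim[OF _ cone_lim], simp)
  \<comment> \<open>The rewriting turns each of the eight entries into positivity of the probability
    for \<open>U\<close>.\<close>
  have "all_equivalent
      [extreme_direction \<mu> J,
       0 < angular_measure N \<mu> (sphere_face N J),
       0 < Lim (at_right 0) (\<lambda>\<epsilon>. lim (\<lambda>n. real n * \<P>(\<omega> in M. X \<omega> \<in> rectangle_region N \<epsilon> n J))),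
       0 < Lim (at_right 0) (\<lambda>\<epsilon>. limsup (\<lambda>n. ereal (real n * \<P>(\<omega> in M. X \<omega> \<in> cone_region N \<epsilon> n J)))),
       0 < \<P>(\<omega> in M\<^sub>Y. \<forall>j. -\<infinity> < Y \<omega> j \<longleftrightarrow> j \<in> J),
       0 < \<P>(\<omega> in M\<^sub>U. \<forall>j. -\<infinity> < U \<omega> j \<longleftrightarrow> j \<in> J),
       0 < \<P>(\<omega> in M\<^sub>T. \<forall>j. -\<infinity> < T \<omega> j \<longleftrightarrow> j \<in> J),
       0 < \<P>(\<omega> in M\<^sub>S. \<forall>j. -\<infinity> < S \<omega> j \<longleftrightarrow> j \<in> J)]"
    unfolding all_equivalent_def extreme_direction_def Lims angular T_S spectral
      mgp_vector_face_pos_iff[OF Y J one sets] ereal_less(2) L face outer box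
    by simp
  moreover have "convergent (\<lambda>n. real n * \<P>(\<omega> in M. X \<omega> \<in> rectangle_region N \<epsilon> n J))" if "0 < \<epsilon>" for \<epsilon>
    using rect[OF that] by (rule convergentI)
  ultimately show ?thesis using rect_lim cone_lim by blast
qed

end
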